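(* Let $k\neq0$ be a real constant, and let $$f(\zeta,u)=F(u^{-ik}\zeta)\,u^{-2}+g\,u^{-2-ik}\zeta,$$ where $F$ is an analytic function of one variable and $g=g(u)$ is a complex-valued function, and suppose that the corresponding vacuum pp-wave satisfies $\alpha\ne0$, $AA^*\neq1$ and $B_1\neq0$ (so that it belongs to the $\mathrm B_{23}$ class). Then the following are equivalent: (i) $d\alpha\wedge d\alpha^*\wedge d\nu=0$; (ii) $\hat\Upsilon=0$; (iii) $g'(u)=0$.
   Context: Setting. Everything is local, on a small connected coordinate domain (with $u>0$) with coordinates $(\zeta,\zeta^*,u,v)$, $\zeta$ complex, $u,v$ real; $^*$ (or a bar) is complex conjugation. A (non-flat) vacuum pp-wave is a metric $ds^2=2\,d\zeta\,d\bar\zeta-2\,du\,dv-2(f+\bar f)\,du^2$ with $f=f(\zeta,u)$ complex analytic in $\zeta$, smooth in $u$, $f_{\zeta\zeta}\neq0$ everywhere. Inequalities "$\ne$" are meant at every point, equalities identically. Normalized tetrad and scalars. Let $a=\tfrac14\log f_{\zeta\zeta}$ and $\alpha=e^{a-a^*}(a_\zeta)^*$. If $\alpha\neq0$, write $\zeta=Z(a,u)$, $L=\log Z_a$ (functions of $(a,u)$), and let $\omega^1=(\alpha^* )^{-1}da=e^{a-a^*}(d\zeta-Z_u\,du)$, $\omega^2=(\omega^1)^*$, $\omega^3=e^{a+a^*}du$, $\omega^4=e^{-a-a^*}\big((f+f^*+Z_uZ_u^* )du+dv-Z_u\,d\zeta^*-Z_u^*\,d\zeta\big)$, so the metric is $2\omega^1\omega^2-2\omega^3\omega^4$.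 Its dual frame $(\delta,\delta^*,\Delta,D)$ is the null tetrad normalized by $\Psi_4=1$, $\gamma=0$ (Newman–Penrose notation). On functions of $(a,a^*,u)$: $\delta Q=\alpha^*Q_a$, $\delta^*Q=\alpha Q_{a^*}$, $\Delta Q=e^{-a-a^*}Q_u$ ($a,a^*$ fixed), $DQ=0$. The remaining spin coefficients are $\mu=e^{-a-a^*}L_u$ and $\nu=e^{-a-3a^*}(Z_{uu}+(f_\zeta)^* )$. Invariants: $A=\delta^*\alpha/\alpha^2$; $B=\mu A-\mu^*$, $B_1=\operatorname{Re}B$, $B_2=\operatorname{Im}B$; and, where $AA^*\neq1$, $X=B/(AA^*-1)$, $X_2=\operatorname{Im}X$, $\hat\nu=\nu+X(\mu+2X^* )/\alpha^*$, $\hat\Upsilon=\Delta(\hat\nu/X^* )-2\hat\nu+1/\alpha-4iXX_2/\alpha^*$. *)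

theory Defs
  imports "HOL-Complex_Analysis.Complex_Analysis"
begin

text \<open>
  A point (or a real tangent vector) is a triple \<open>(\<zeta>, u, v)\<close>. Complex-valued 1-forms at a point
  are real-linear maps into the complex numbers.
\<close>

type_synonym point = "complex \<times> real \<times> real"

definition wedge3 ::
  "('v \<Rightarrow> complex) \<Rightarrow> ('v \<Rightarrow> complex) \<Rightarrow> ('v \<Rightarrow> complex) \<Rightarrow> 'v \<Rightarrow> 'v \<Rightarrow> 'v \<Rightarrow> complex" where
  "wedge3 \<phi> \<psi> \<theta> x y z =
     \<phi> x * (\<psi> y * \<theta> z - \<psi> z * \<theta> y)
   - \<phi> y * (\<psi> x * \<theta> z - \<psi> z * \<theta> x)
   + \<phi> z * (\<psi> x * \<theta> y - \<psi> y * \<theta> x)"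

definition differential :: "(point \<Rightarrow> complex) \<Rightarrow> point \<Rightarrow> point \<Rightarrow> complex" where
  "differential Q p = frechet_derivative Q (at p)"

text \<open>Infinite differentiability; meant for open \<open>S\<close> only.\<close>

definition smooth_on :: "real set \<Rightarrow> (real \<Rightarrow> complex) \<Rightarrow> bool" where
  "smooth_on S h \<longleftrightarrow>
     (\<forall>n. \<forall>t\<in>S. ((\<lambda>q t. vector_derivative q (at t)) ^^ n) h differentiable (at t))"

locale pp_wave =
  fixes M :: "point set" and f :: "complex \<Rightarrow> real \<Rightarrow> complex"
  assumes open_domain: "open M"
    and connected_domain: "connected M"
    and u_pos: "(\<zeta>, u, v) \<in> M \<Longrightarrow> u > 0"
    and f_analytic: "(\<zeta>, u, v) \<in> M \<Longrightarrow> (\<lambda>z. f z u) analytic_on {\<zeta>}"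
    and f_smooth: "smooth_on {u. \<exists>v. (\<zeta>, u, v) \<in> M} (\<lambda>u. f \<zeta> u)"
    and f_zz_nonzero: "(\<zeta>, u, v) \<in> M \<Longrightarrow> (deriv ^^ 2) (\<lambda>z. f z u) \<zeta> \<noteq> 0"
begin

text \<open>The line element, as a quadratic form in the tangent vector \<open>(d\<zeta>, du, dv)\<close>.\<close>

definition metric :: "point \<Rightarrow> point \<Rightarrow> complex" where
  "metric = (\<lambda>(\<zeta>, u, v) (d\<zeta>, du, dv).
     2 * d\<zeta> * cnj d\<zeta> - 2 * of_real du * of_real dv
     - 2 * (f \<zeta> u + cnj (f \<zeta> u)) * (of_real du)\<^sup>2)"

end

text \<open>
  The domain is small enough for the following choices: \<open>a\<close> is a continuous branch of
  \<open>1/4 log f\<^sub>\<zeta>\<^sub>\<zeta>\<close>, the map \<open>(\<zeta>, u) \<mapsto> (a, u)\<close> is injective with inverse \<open>(a, u) \<mapsto> (Z, u)\<close>,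
  and \<open>L\<close> is a continuous branch of \<open>log Z\<^sub>a\<close>. Nothing depends on \<open>v\<close>, so that \<open>a\<close> is
  a function on the projection of \<open>M\<close> to the \<open>(\<zeta>, u)\<close> coordinates. In \<open>Z b u\<close> and \<open>L b u\<close> the
  variable \<open>b\<close> is the value of the coordinate \<open>a\<close>; these functions matter only on the
  range of \<open>(a, u)\<close>.
\<close>

definition base_proj :: "point \<Rightarrow> complex \<times> real" where
  "base_proj = (\<lambda>(\<zeta>, u, v). (\<zeta>, u))"

definition Zinv :: "point set \<Rightarrow> (complex \<Rightarrow> real \<Rightarrow> complex) \<Rightarrow> complex \<Rightarrow> real \<Rightarrow> complex" where
  "Zinv M a b u = (THE \<zeta>. (\<zeta>, u) \<in> base_proj ` M \<and> a \<zeta> u = b)"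

locale normalized_pp_wave = pp_wave M f
  for M :: "point set" and f :: "complex \<Rightarrow> real \<Rightarrow> complex" +
  fixes a :: "complex \<Rightarrow> real \<Rightarrow> complex" and L :: "complex \<Rightarrow> real \<Rightarrow> complex"
  assumes a_continuous: "continuous_on (base_proj ` M) (\<lambda>(\<zeta>, u). a \<zeta> u)"
    and a_branch: "(\<zeta>, u, v) \<in> M \<Longrightarrow> exp (4 * a \<zeta> u) = (deriv ^^ 2) (\<lambda>z. f z u) \<zeta>"
    and a_inj: "inj_on (\<lambda>(\<zeta>, u). (a \<zeta> u, u)) (base_proj ` M)"
    and L_continuous:
      "continuous_on ((\<lambda>(\<zeta>, u). (a \<zeta> u, u)) ` (base_proj ` M)) (\<lambda>(b, u). L b u)"
    and L_branch:
      "(\<zeta>, u, v) \<in> M \<Longrightarrow> exp (L (a \<zeta> u) u) = deriv (\<lambda>b. Zinv M a b u) (a \<zeta> u)"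
begin

definition Z :: "complex \<Rightarrow> real \<Rightarrow> complex" where
  "Z = Zinv M a"

definition Z_u :: "complex \<Rightarrow> real \<Rightarrow> complex" where
  "Z_u b u = vector_derivative (\<lambda>t. Z b t) (at u)"

definition Z_uu :: "complex \<Rightarrow> real \<Rightarrow> complex" where
  "Z_uu b u = vector_derivative (\<lambda>t. Z_u b t) (at u)"

definition L_u :: "complex \<Rightarrow> real \<Rightarrow> complex" where
  "L_u b u = vector_derivative (\<lambda>t. L b t) (at u)"

definition alpha :: "point \<Rightarrow> complex" where
  "alpha = (\<lambda>(\<zeta>, u, v). exp (a \<zeta> u - cnj (a \<zeta> u)) * cnj (deriv (\<lambda>z. a z u) \<zeta>))"

definition mu :: "point \<Rightarrow> complex" where
  "mu = (\<lambda>(\<zeta>, u, v). exp (- a \<zeta> u - cnj (a \<zeta> u)) * L_u (a \<zeta> u) u)"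

definition nu :: "point \<Rightarrow> complex" where
  "nu = (\<lambda>(\<zeta>, u, v). exp (- a \<zeta> u - 3 * cnj (a \<zeta> u)) *
           (Z_uu (a \<zeta> u) u + cnj (deriv (\<lambda>z. f z u) \<zeta>)))"

definition \<omega>1 :: "point \<Rightarrow> point \<Rightarrow> complex" where
  "\<omega>1 = (\<lambda>(\<zeta>, u, v) (d\<zeta>, du, dv).
     exp (a \<zeta> u - cnj (a \<zeta> u)) * (d\<zeta> - Z_u (a \<zeta> u) u * of_real du))"

definition \<omega>2 :: "point \<Rightarrow> point \<Rightarrow> complex" where
  "\<omega>2 p x = cnj (\<omega>1 p x)"

definition \<omega>3 :: "point \<Rightarrow> point \<Rightarrow> complex" where
  "\<omega>3 = (\<lambda>(\<zeta>, u, v) (d\<zeta>, du, dv). exp (a \<zeta> u + cnj (a \<zeta> u)) * of_real du)"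

definition \<omega>4 :: "point \<Rightarrow> point \<Rightarrow> complex" where
  "\<omega>4 = (\<lambda>(\<zeta>, u, v) (d\<zeta>, du, dv). exp (- a \<zeta> u - cnj (a \<zeta> u)) *
     ((f \<zeta> u + cnj (f \<zeta> u) + Z_u (a \<zeta> u) u * cnj (Z_u (a \<zeta> u) u)) * of_real du + of_real dv
      - Z_u (a \<zeta> u) u * cnj d\<zeta> - cnj (Z_u (a \<zeta> u) u) * d\<zeta>))"

lemma metric_eq_coframe: "metric p x = 2 * \<omega>1 p x * \<omega>2 p x - 2 * \<omega>3 p x * \<omega>4 p x"
proof -
  obtain \<zeta> u v where p: "p = (\<zeta>, u, v)" by (cases p)
  obtain d\<zeta> du dv where x: "x = (d\<zeta>, du, dv)" by (cases x)
  define z where "z = Z_u (a \<zeta> u) u"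
  define E where "E = exp (a \<zeta> u - cnj (a \<zeta> u))"
  define G where "G = exp (a \<zeta> u + cnj (a \<zeta> u))"
  have E: "E * cnj E = 1"
    by (simp add: E_def exp_cnj flip: exp_add)
  have G: "exp (- a \<zeta> u - cnj (a \<zeta> u)) = inverse G" and G0: "G \<noteq> 0"
    by (simp_all add: G_def flip: exp_minus)
  have 1: "\<omega>1 p x * \<omega>2 p x = (E * cnj E) * ((d\<zeta> - z * of_real du) * cnj (d\<zeta> - z * of_real du))"
    by (simp add: p x \<omega>1_def \<omega>2_def z_def E_def)
  have 2: "\<omega>3 p x * \<omega>4 p x = of_real du * ((f \<zeta> u + cnj (f \<zeta> u) + z * cnj z) * of_real du
      + of_real dv - z * cnj d\<zeta> - cnj z * d\<zeta>)"
    using G0 unfolding p x \<omega>3_def \<omega>4_def by (simp add: G flip: G_def z_def)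
  show ?thesis
    unfolding mult.assoc 1 2 E by (simp add: p x metric_def algebra_simps power2_eq_square)
qed

text \<open>
  The derivatives \<open>(\<delta>Q, \<delta>\<^sup>*Q, \<Delta>Q, DQ)\<close> along the dual frame are the components of \<open>dQ\<close> in the
  coframe.
\<close>

definition frame_derivs ::
  "(point \<Rightarrow> complex) \<Rightarrow> point \<Rightarrow> complex \<times> complex \<times> complex \<times> complex" where
  "frame_derivs Q p = (THE c. case c of (c1, c2, c3, c4) \<Rightarrow>
     \<forall>x. differential Q p x = c1 * \<omega>1 p x + c2 * \<omega>2 p x + c3 * \<omega>3 p x + c4 * \<omega>4 p x)"

lemma frame_derivs_eqI:
  assumes "\<And>x. differential Q p x = c1 * \<omega>1 p x + c2 * \<omega>2 p x + c3 * \<omega>3 p x + c4 * \<omega>4 p x"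
  shows "frame_derivs Q p = (c1, c2, c3, c4)"
  unfolding frame_derivs_def
proof (rule the_equality)
  show "case (c1, c2, c3, c4) of (c1, c2, c3, c4) \<Rightarrow>
     \<forall>x. differential Q p x = c1 * \<omega>1 p x + c2 * \<omega>2 p x + c3 * \<omega>3 p x + c4 * \<omega>4 p x"
    using assms by simp
next
  fix c :: "complex \<times> complex \<times> complex \<times> complex"
  obtain d1 d2 d3 d4 where c: "c = (d1, d2, d3, d4)" by (cases c)
  assume "case c of (c1, c2, c3, c4) \<Rightarrow>
     \<forall>x. differential Q p x = c1 * \<omega>1 p x + c2 * \<omega>2 p x + c3 * \<omega>3 p x + c4 * \<omega>4 p x"
  then have eq: "c1 * \<omega>1 p x + c2 * \<omega>2 p x + c3 * \<omega>3 p x + c4 * \<omega>4 p x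
      = d1 * \<omega>1 p x + d2 * \<omega>2 p x + d3 * \<omega>3 p x + d4 * \<omega>4 p x" for x
    unfolding c prod.case assms by (rule spec)
  obtain \<zeta> u v where p: "p = (\<zeta>, u, v)" by (cases p)
  note defs = p \<omega>1_def \<omega>2_def \<omega>3_def \<omega>4_def
  have 4: "c4 = d4"
    using eq[of "(0, 0, 1)"] by (simp add: defs)
  define E where "E = exp (a \<zeta> u - cnj (a \<zeta> u))"
  have E0: "E \<noteq> 0" "cnj E \<noteq> 0" by (simp_all add: E_def)
  have r: "c1 * E + c2 * cnj E = d1 * E + d2 * cnj E"
    using eq[of "(1, 0, 0)"] 4 by (simp add: defs E_def)
  have "c1 * (E * \<i>) - c2 * (cnj E * \<i>) = d1 * (E * \<i>) - d2 * (cnj E * \<i>)"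
    using eq[of "(\<i>, 0, 0)"] 4 by (simp add: defs E_def)
  then have "\<i> * (c1 * E - c2 * cnj E) = \<i> * (d1 * E - d2 * cnj E)"
    by (simp add: algebra_simps)
  then have i: "c1 * E - c2 * cnj E = d1 * E - d2 * cnj E"
    by simp
  have "2 * (c1 * E) = (c1 * E + c2 * cnj E) + (c1 * E - c2 * cnj E)" by simp
  also have "\<dots> = 2 * (d1 * E)" unfolding r i by simp
  finally have 1: "c1 = d1" using E0 by simp
  then have 2: "c2 = d2" using r E0 by simp
  have "c3 = d3"
    using eq[of "(0, 1, 0)"] 1 2 4 by (simp add: defs)
  then show "c = (c1, c2, c3, c4)" using 1 2 4 c by simp
qed

definition delta_star :: "(point \<Rightarrow> complex) \<Rightarrow> point \<Rightarrow> complex" where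
  "delta_star Q p = (case frame_derivs Q p of (c1, c2, c3, c4) \<Rightarrow> c2)"

definition Delta :: "(point \<Rightarrow> complex) \<Rightarrow> point \<Rightarrow> complex" where
  "Delta Q p = (case frame_derivs Q p of (c1, c2, c3, c4) \<Rightarrow> c3)"

definition A :: "point \<Rightarrow> complex" where
  "A p = delta_star alpha p / (alpha p)\<^sup>2"

definition B :: "point \<Rightarrow> complex" where
  "B p = mu p * A p - cnj (mu p)"

definition X :: "point \<Rightarrow> complex" where
  "X p = B p / (A p * cnj (A p) - 1)"

definition nu_hat :: "point \<Rightarrow> complex" where
  "nu_hat p = nu p + X p * (mu p + 2 * cnj (X p)) / cnj (alpha p)"

definition Upsilon_hat :: "point \<Rightarrow> complex" where
  "Upsilon_hat p = Delta (\<lambda>q. nu_hat q / cnj (X q)) p - 2 * nu_hat p + 1 / alpha p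
     - 4 * \<i> * X p * of_real (Im (X p)) / cnj (alpha p)"

end

end

theory Submission
  imports Defs
begin

text \<open>
  Put \<open>c = (1 + ik)/2\<close>, \<open>w = u\<^sup>-\<^sup>i\<^sup>k\<zeta>\<close> and \<open>\<beta> = a + c log u\<close>. The form of \<open>f\<close> gives \<open>exp (4\<beta>) = F''(w)\<close>,
  so that \<open>w = W(\<beta>)\<close> with \<open>W' = q(w)\<close>, \<open>q = 4F''/F'''\<close>, and \<open>Z(a, u) = u\<^sup>i\<^sup>kW(a + c log u)\<close>.
  With \<open>E = exp \<beta>\<close>, \<open>h = 1/(E E\<^sup>*)\<close> and \<open>G = F'(w) + g(u)\<close> the invariants become
  \<open>\<alpha> = E/(E q)\<^sup>*\<close>, \<open>A = -(1 + q'(w))\<^sup>*\<close>, \<open>X = -c h\<close>, and \<open>\<nu>\<close> is \<open>G\<^sup>*/(E E\<^sup>*\<^sup>3)\<close> plus a function of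
  \<open>w\<close> alone. As \<open>\<alpha>\<close> depends on \<open>w\<close> alone and \<open>d\<beta> \<and> d\<beta>\<^sup>*\<close> enters \<open>d\<alpha> \<and> d\<alpha>\<^sup>*\<close> with the factor
  \<open>\<alpha>\<alpha>\<^sup>*(1 - AA\<^sup>*) \<noteq> 0\<close>, the wedge product vanishes precisely when \<open>g' = 0\<close>. Moreover
  \<open>\<nu>\<close>-hat divided by \<open>X\<^sup>*\<close> collapses to \<open>2ik w/E\<^sup>*\<^sup>2 - (G/E\<^sup>2)\<^sup>*/c\<^sup>*\<close>, and applying \<open>\<Delta>\<close> to this
  cancels every term of \<open>\<Upsilon>\<close>-hat except a nonzero multiple of \<open>(g')\<^sup>*\<close>.
\<close>

section \<open>Complex powers of a positive real variable, and lifts through the exponential\<close>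

lemma has_derivative_cong_nhds:
  assumes "(f has_derivative f') (at x)" "\<forall>\<^sub>F y in nhds x. f y = g y"
  shows "(g has_derivative f') (at x)"
proof (rule has_derivative_transform_eventually[OF assms(1)])
  show "\<forall>\<^sub>F y in at x. f y = g y"
    using assms(2) by (simp add: eventually_at_filter eventually_mono)
qed (use eventually_nhds_x_imp_x[OF assms(2)] in auto)

lemma has_vector_derivative_cong_nhds:
  assumes "(f has_vector_derivative f') (at x)" "\<forall>\<^sub>F y in nhds x. f y = g y"
  shows "(g has_vector_derivative f') (at x)"
  using assms unfolding has_vector_derivative_def by (rule has_derivative_cong_nhds)

text \<open>Near \<open>x\<close> the continuous \<open>h\<close> differs from \<open>h x\<close> by
  less than pi, so it equals the principal logarithm of \<open>G y / G x\<close> plus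
  \<open>h x\<close>. This gives derivatives of \<open>a\<close> and \<open>L\<close>, which are
  known only as continuous branches of logarithms.\<close>

lemma has_derivative_exp_lift:
  fixes h G :: "'a::real_normed_vector \<Rightarrow> complex"
  assumes cont: "isCont h x" and eq: "\<forall>\<^sub>F y in nhds x. exp (h y) = G y"
    and G: "(G has_derivative G') (at x)"
  shows "(h has_derivative (\<lambda>v. G' v / G x)) (at x)"
proof (rule has_derivative_cong_nhds)
  have Gx: "G x = exp (h x)" using eventually_nhds_x_imp_x[OF eq] by simp
  then have G0: "G x \<noteq> 0" by simp
  have "((\<lambda>y. G y / G x) has_derivative (\<lambda>v. G' v / G x)) (at x)"
    using has_derivative_mult_left[OF G, of "inverse (G x)"] by (simp add: divide_inverse)
  moreover have "(Ln has_derivative (\<lambda>v. v)) (at (G x / G x))"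
    using has_field_derivative_Ln[of "G x / G x"] G0
    by (simp add: has_field_derivative_def mult_1_left[abs_def])
  ultimately have "((\<lambda>y. Ln (G y / G x)) has_derivative (\<lambda>v. G' v / G x)) (at x)"
    by (rule has_derivative_compose)
  then show "((\<lambda>y. Ln (G y / G x) + h x) has_derivative (\<lambda>v. G' v / G x)) (at x)"
    by (auto intro!: derivative_eq_intros)
  have "(h \<longlongrightarrow> h x) (nhds x)"
    using cont by (simp add: isCont_def tendsto_nhds_iff)
  then have "\<forall>\<^sub>F y in nhds x. dist (h y) (h x) < pi"
    by (rule tendstoD) simp
  with eq show "\<forall>\<^sub>F y in nhds x. Ln (G y / G x) + h x = h y"
  proof eventually_elim
    case (elim y)
    have "\<bar>Im (h y - h x)\<bar> < pi"
      using elim(2) abs_Im_le_cmod[of "h y - h x"] by (simp add: dist_norm)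
    then have "Ln (exp (h y - h x)) = h y - h x"
      by (intro Ln_exp) auto
    moreover have "G y / G x = exp (h y - h x)"
      using elim(1) Gx by (simp add: exp_diff)
    ultimately show ?case by simp
  qed
qed

section \<open>Powers of a positive real variable with complex exponent\<close>

text \<open>Agrees with \<open>powr\<close> for positive \<open>u\<close>; the exponential form
  makes the value nonzero and the addition law valid without side conditions.\<close>

definition upow :: "complex \<Rightarrow> real \<Rightarrow> complex" where
  "upow z u = exp (z * of_real (ln u))"

lemma powr_eq_upow: "u > 0 \<Longrightarrow> of_real u powr z = upow z u"
  by (simp add: powr_def upow_def Ln_of_real)

lemma upow_nonzero [simp]: "upow z u \<noteq> 0"
  by (simp add: upow_def)

lemma upow_add: "upow (y + z) u = upow y u * upow z u"
  by (simp add: upow_def distrib_right exp_add)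

lemma upow_diff: "upow (y - z) u = upow y u * upow (- z) u"
  using upow_add[of y "- z" u] by simp

lemma upow_0 [simp]: "upow 0 u = 1"
  by (simp add: upow_def)

lemma upow_1: "u > 0 \<Longrightarrow> upow 1 u = of_real u"
  by (simp add: upow_def exp_of_real)

lemma upow_minus: "upow (- z) u = inverse (upow z u)"
  by (simp add: upow_def exp_minus)

lemma cnj_upow: "cnj (upow z u) = upow (cnj z) u"
  by (simp add: upow_def exp_cnj)

lemma has_vector_derivative_upow:
  assumes "u > 0"
  shows "(upow z has_vector_derivative z / of_real u * upow z u) (at u)"
proof -
  have "((\<lambda>t. z * of_real (ln t)) has_vector_derivative z * of_real (1 / u)) (at u)"
    using assms by (auto intro!: derivative_eq_intros
        simp: has_vector_derivative_def scaleR_conv_of_real field_simps)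
  from field_vector_diff_chain_at[OF this DERIV_exp] show ?thesis
    by (simp add: upow_def[abs_def] o_def)
qed

lemma has_derivative_upow:
  assumes "fst (snd p) > 0"
  shows "((\<lambda>p :: point. upow z (fst (snd p))) has_derivative
    (\<lambda>x. of_real (fst (snd x)) * (z / of_real (fst (snd p)) * upow z (fst (snd p))))) (at p)"
proof -
  have "((\<lambda>p :: point. fst (snd p)) has_derivative (\<lambda>x. fst (snd x))) (at p)"
    by (intro has_derivative_fst has_derivative_snd has_derivative_ident)
  from has_derivative_compose[OF this has_vector_derivative_upow[OF assms, of z,
        unfolded has_vector_derivative_def]] show ?thesis
    by (simp add: scaleR_conv_of_real)
qed

lemma has_derivative_ln_u:
  assumes "fst (snd p) > 0"
  shows "((\<lambda>p :: point. of_real (ln (fst (snd p))) :: complex) has_derivative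
    (\<lambda>x. of_real (fst (snd x)) / of_real (fst (snd p)))) (at p)"
  using assms by (auto intro!: derivative_eq_intros simp: divide_inverse)

section \<open>The invariants in terms of \<open>w = u\<^sup>-\<^sup>i\<^sup>k\<zeta>\<close>\<close>

locale power_wave = normalized_pp_wave M f a L
  for M :: "point set" and f a L :: "complex \<Rightarrow> real \<Rightarrow> complex" +
  fixes F :: "complex \<Rightarrow> complex" and g :: "real \<Rightarrow> complex" and k :: real
  assumes F_analytic:
      "F analytic_on {of_real u powr (- \<i> * of_real k) * \<zeta> |\<zeta> u v. (\<zeta>, u, v) \<in> M}"
    and f_eq: "(\<zeta>, u, v) \<in> M \<Longrightarrow>
      f \<zeta> u = F (of_real u powr (- \<i> * of_real k) * \<zeta>) * of_real u powr (- 2)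
        + g u * of_real u powr (- 2 - \<i> * of_real k) * \<zeta>"
    and alpha_nonzero: "p \<in> M \<Longrightarrow> alpha p \<noteq> 0"
    and A_nondegenerate: "p \<in> M \<Longrightarrow> A p * cnj (A p) \<noteq> 1"
begin

section \<open>Constants and the coordinates \<open>w\<close> and \<open>beta\<close>\<close>

definition ik :: complex where "ik = \<i> * of_real k"

text \<open>Chosen so that 4 c = 2 + 2 ik compensates the power of u in \<open>f_zeta_zeta\<close>;
  see \<open>exp_4_beta\<close>.\<close>

definition c :: complex where "c = (1 + ik) / 2"

lemma cnj_ik [simp]: "cnj ik = - ik"
  by (simp add: ik_def)

lemma ik_eq: "ik = 2 * c - 1"
  by (simp add: c_def field_simps)

lemma cnj_c: "cnj c = 1 - c"
  by (simp add: c_def field_simps)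

lemma c_nonzero [simp]: "c \<noteq> 0"
proof
  assume "c = 0"
  then have "Re c = 0" by simp
  then show False by (simp add: c_def ik_def)
qed

definition w :: "point \<Rightarrow> complex" where
  "w p = upow (- ik) (fst (snd p)) * fst p"

definition beta :: "point \<Rightarrow> complex" where
  "beta p = a (fst p) (fst (snd p)) + c * of_real (ln (fst (snd p)))"

definition F2 :: "complex \<Rightarrow> complex" where "F2 = deriv (deriv F)"

text \<open>This is dw/dbeta, obtained by differentiating exp (4 beta) = F2(w).\<close>

definition q :: "complex \<Rightarrow> complex" where "q z = 4 * F2 z / deriv F2 z"

lemma u_pos': "p \<in> M \<Longrightarrow> fst (snd p) > 0"
  using u_pos by (cases p) auto

lemma F_analytic': "F analytic_on w ` M"
proof -
  have "w ` M \<subseteq> {of_real u powr (- \<i> * of_real k) * \<zeta> |\<zeta> u v. (\<zeta>, u, v) \<in> M}"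
    using u_pos by (auto simp: w_def ik_def powr_eq_upow) (metis mult_minus_left powr_eq_upow)
  then show ?thesis using F_analytic analytic_on_subset by blast
qed

lemma f_eq': "(\<zeta>, u, v) \<in> M \<Longrightarrow>
  f \<zeta> u = F (upow (- ik) u * \<zeta>) * upow (- 2) u + g u * upow (- 2 - ik) u * \<zeta>"
  using f_eq[of \<zeta> u v] u_pos[of \<zeta> u v] by (simp add: powr_eq_upow ik_def)

lemma F_deriv_analytic:
    "deriv F analytic_on w ` M" "F2 analytic_on w ` M"
    "deriv F2 analytic_on w ` M"
  unfolding F2_def by (intro analytic_deriv F_analytic')+

lemma analytic_DERIV:
  assumes "G analytic_on w ` M" "p \<in> M"
  shows "(G has_field_derivative deriv G (w p)) (at (w p))"
  using assms analytic_on_imp_differentiable_at field_differentiable_derivI by blast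

lemma eventually_slice_zeta:
  assumes "(\<zeta>, u, v) \<in> M" shows "\<forall>\<^sub>F z in nhds \<zeta>. (z, u, v) \<in> M"
proof -
  have "open ((\<lambda>z. (z, u, v)) -` M)"
    by (intro open_vimage open_domain continuous_intros)
  then show ?thesis
    using assms eventually_nhds_in_open[of "(\<lambda>z. (z, u, v)) -` M" \<zeta>] by simp
qed

lemma eventually_slice_u:
  assumes "(\<zeta>, u, v) \<in> M" shows "\<forall>\<^sub>F t in nhds u. (\<zeta>, t, v) \<in> M"
proof -
  have "open ((\<lambda>t. (\<zeta>, t, v)) -` M)"
    by (intro open_vimage open_domain continuous_intros)
  then show ?thesis
    using assms eventually_nhds_in_open[of "(\<lambda>t. (\<zeta>, t, v)) -` M" u] by simp
qed

section \<open>Derivatives of \<open>f\<close>, \<open>beta\<close> and \<open>a\<close>\<close>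

lemma f_zeta:
  assumes "(\<zeta>, u, v) \<in> M"
  shows "deriv (\<lambda>z. f z u) \<zeta> = upow (- 2 - ik) u * (deriv F (w (\<zeta>, u, v)) + g u)"
proof (rule DERIV_imp_deriv)
  have "((\<lambda>z. F (upow (- ik) u * z) * upow (- 2) u + g u * upow (- 2 - ik) u * z)
      has_field_derivative
      deriv F (w (\<zeta>, u, v)) * upow (- ik) u * upow (- 2) u + g u * upow (- 2 - ik) u) (at \<zeta>)"
    using analytic_DERIV[OF F_analytic' assms]
    by (auto intro!: derivative_eq_intros DERIV_chain2[where f = F] simp: w_def)
  moreover have "\<forall>\<^sub>F z in nhds \<zeta>. F (upow (- ik) u * z) * upow (- 2) u
      + g u * upow (- 2 - ik) u * z = f z u"
    using eventually_slice_zeta[OF assms] by eventually_elim (simp add: f_eq')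
  ultimately have "((\<lambda>z. f z u) has_field_derivative
      deriv F (w (\<zeta>, u, v)) * upow (- ik) u * upow (- 2) u + g u * upow (- 2 - ik) u) (at \<zeta>)"
    unfolding has_field_derivative_def by (rule has_derivative_cong_nhds)
  then show "((\<lambda>z. f z u) has_field_derivative
      upow (- 2 - ik) u * (deriv F (w (\<zeta>, u, v)) + g u)) (at \<zeta>)"
    unfolding upow_diff by (simp add: algebra_simps)
qed

text \<open>The term with \<open>g\<close> is linear in zeta and drops out, so \<open>a\<close> does
  not see \<open>g\<close>.\<close>

lemma f_zeta_zeta:
  assumes "(\<zeta>, u, v) \<in> M"
  shows "(deriv ^^ 2) (\<lambda>z. f z u) \<zeta> = upow (- 2 - 2 * ik) u * F2 (w (\<zeta>, u, v))"
proof -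
  have "deriv (deriv (\<lambda>z. f z u)) \<zeta>
      = deriv (\<lambda>z. upow (- 2 - ik) u * (deriv F (upow (- ik) u * z) + g u)) \<zeta>"
  proof (rule deriv_cong_ev)
    show "\<forall>\<^sub>F z in nhds \<zeta>. deriv (\<lambda>z. f z u) z
        = upow (- 2 - ik) u * (deriv F (upow (- ik) u * z) + g u)"
      using eventually_slice_zeta[OF assms] by eventually_elim (simp add: f_zeta w_def)
  qed simp
  also have "\<dots> = upow (- 2 - ik) u * (F2 (w (\<zeta>, u, v)) * upow (- ik) u)"
    using analytic_DERIV[OF F_deriv_analytic(1) assms]
    by (intro DERIV_imp_deriv)
      (auto intro!: derivative_eq_intros DERIV_chain2[where f = "deriv F"] simp: w_def F2_def)
  also have "\<dots> = upow (- 2 - 2 * ik) u * F2 (w (\<zeta>, u, v))"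
    using upow_add[of "- 2 - ik" "- ik" u] by (simp add: algebra_simps)
  finally show ?thesis by (simp add: numeral_2_eq_2)
qed

lemma exp_4_beta:
  assumes "p \<in> M" shows "exp (4 * beta p) = F2 (w p)"
proof -
  obtain \<zeta> u v where p: "p = (\<zeta>, u, v)" by (cases p)
  have "4 * beta p = 4 * a \<zeta> u + (2 + 2 * ik) * of_real (ln u)"
    by (simp add: p beta_def c_def field_simps)
  then have "exp (4 * beta p) = exp (4 * a \<zeta> u) * upow (2 + 2 * ik) u"
    by (simp add: upow_def exp_add)
  also have "\<dots> = F2 (w p) * (upow (- (2 + 2 * ik)) u * upow (2 + 2 * ik) u)"
    using assms by (simp add: p a_branch f_zeta_zeta)
  also have "upow (- (2 + 2 * ik)) u * upow (2 + 2 * ik) u = 1"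
    unfolding upow_minus by simp
  finally show ?thesis by simp
qed

lemma isCont_beta:
  assumes "p \<in> M" shows "isCont beta p"
proof -
  have "continuous_on M (\<lambda>p. (\<lambda>(\<zeta>, u). a \<zeta> u) (base_proj p))"
    by (rule continuous_on_compose2[OF a_continuous])
      (auto simp: base_proj_def split_beta intro!: continuous_intros)
  then have "isCont (\<lambda>p. a (fst p) (fst (snd p))) p"
    using assms open_domain
    by (simp add: base_proj_def split_beta continuous_on_eq_continuous_at)
  then show ?thesis unfolding beta_def[abs_def]
    by (intro continuous_intros has_derivative_continuous[OF has_derivative_ln_u] u_pos' assms)
qed

definition dw :: "point \<Rightarrow> point \<Rightarrow> complex" where
  "dw p x = upow (- ik) (fst (snd p)) * fst x
     - ik * w p / of_real (fst (snd p)) * of_real (fst (snd x))"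

text \<open>Together with its conjugate and du this is the basis in which all later differentials
  are written.\<close>

definition dbeta :: "point \<Rightarrow> point \<Rightarrow> complex" where
  "dbeta p x = dw p x / q (w p)"

lemma has_derivative_w:
  assumes "p \<in> M" shows "(w has_derivative dw p) (at p)"
  unfolding w_def[abs_def] dw_def[abs_def]
  by (rule derivative_eq_intros has_derivative_upow u_pos' assms refl)+
    (auto simp: algebra_simps)

text \<open>Continuity suffices: lifting exp (4 beta) = F2(w) through the exponential gives 4 dbeta
  = (F2'/F2) dw.\<close>

lemma has_derivative_beta:
  assumes "p \<in> M" shows "(beta has_derivative dbeta p) (at p)"
proof -
  have "((\<lambda>p. F2 (w p)) has_derivative (\<lambda>x. deriv F2 (w p) * dw p x)) (at p)"
    using analytic_DERIV[OF F_deriv_analytic(2) assms]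
    by (intro has_derivative_compose[OF has_derivative_w[OF assms]])
      (simp add: has_field_derivative_def)
  moreover have "\<forall>\<^sub>F p in nhds p. exp (4 * beta p) = F2 (w p)"
    using eventually_nhds_in_open[OF open_domain assms] by eventually_elim (rule exp_4_beta)
  moreover have "isCont (\<lambda>p. 4 * beta p) p"
    by (intro continuous_intros isCont_beta assms)
  ultimately have "((\<lambda>p. 4 * beta p) has_derivative
      (\<lambda>x. deriv F2 (w p) * dw p x / F2 (w p))) (at p)"
    by (intro has_derivative_exp_lift)
  then have "((\<lambda>p. (1 / 4) * (4 * beta p)) has_derivative
      (\<lambda>x. (1 / 4) * (deriv F2 (w p) * dw p x / F2 (w p)))) (at p)"
    by (rule has_derivative_mult_right)
  then show ?thesis by (simp add: dbeta_def[abs_def] q_def mult.commute)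
qed

lemma a_zeta:
  assumes "(\<zeta>, u, v) \<in> M"
  shows "deriv (\<lambda>z. a z u) \<zeta> = upow (- ik) u / q (w (\<zeta>, u, v))"
proof (rule DERIV_imp_deriv)
  have "((\<lambda>z. (z, u, v)) has_derivative (\<lambda>x. (x, 0, 0))) (at \<zeta>)"
    by (intro has_derivative_Pair has_derivative_ident has_derivative_const)
  from has_derivative_compose[OF this has_derivative_beta[OF assms]]
  have "((\<lambda>z. beta (z, u, v) - c * of_real (ln u)) has_derivative
      (\<lambda>x. dbeta (\<zeta>, u, v) (x, 0, 0) - 0)) (at \<zeta>)"
    by (intro has_derivative_diff has_derivative_const)
  then have "((\<lambda>z. a z u) has_derivative (\<lambda>x. dbeta (\<zeta>, u, v) (x, 0, 0))) (at \<zeta>)"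
    by (simp add: beta_def)
  then show "((\<lambda>z. a z u) has_field_derivative upow (- ik) u / q (w (\<zeta>, u, v))) (at \<zeta>)"
    unfolding has_field_derivative_def
    by (rule has_derivative_eq_rhs) (simp add: fun_eq_iff dbeta_def dw_def)
qed

text \<open>If q vanished, the convention x / 0 = 0 would make the formula of \<open>a_zeta\<close>
  zero, and with it alpha.\<close>

lemma q_nonzero:
  assumes "p \<in> M" shows "q (w p) \<noteq> 0"
proof -
  obtain \<zeta> u v where p: "p = (\<zeta>, u, v)" by (cases p)
  show ?thesis using alpha_nonzero[OF assms] assms
    by (auto simp: p alpha_def a_zeta)
qed

text \<open>A zero denominator would make the quotient \<open>q\<close> zero by convention.\<close>

lemma F3_nonzero: "p \<in> M \<Longrightarrow> deriv F2 (w p) \<noteq> 0"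
  using q_nonzero[of p] by (auto simp: q_def)

lemma q_analytic: "q analytic_on w ` M" "deriv q analytic_on w ` M"
proof -
  show "q analytic_on w ` M"
    unfolding q_def[abs_def] by (intro analytic_intros F_deriv_analytic) (auto simp: F3_nonzero)
  then show "deriv q analytic_on w ` M" by (rule analytic_deriv)
qed

section \<open>The inverse function \<open>Z\<close> and its derivatives\<close>

lemma Z_eqI:
  assumes "(z, t, v) \<in> M" "a z t = b" shows "Z b t = z"
  unfolding Z_def Zinv_def
proof (rule the_equality)
  show "(z, t) \<in> base_proj ` M \<and> a z t = b"
    using assms by (force simp: base_proj_def)
  then show "y = z" if "(y, t) \<in> base_proj ` M \<and> a y t = b" for y
    using that inj_onD[OF a_inj, of "(y, t)" "(z, t)"] by auto
qed

text \<open>Since F2' is nonzero at \<open>w p\<close>, \<open>F2\<close> is injective on a small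
  ball with open image; the chain rule gives the derivative of the inverse.\<close>

lemma F2_local_inverse:
  assumes "p \<in> M"
  obtains D V where "open D" "w p \<in> D" "open (F2 ` D)" "\<And>z. z \<in> D \<Longrightarrow> V (F2 z) = z"
    "\<And>z. z \<in> D \<Longrightarrow> (V has_field_derivative 1 / deriv F2 z) (at (F2 z))"
proof -
  have "F2 analytic_on {w p}"
    using F_deriv_analytic(2) assms by (auto intro: analytic_on_subset)
  then obtain T where T: "open T" "w p \<in> T" "F2 holomorphic_on T"
    by (auto simp: analytic_at)
  obtain r where r: "r > 0" "ball (w p) r \<subseteq> T" "open (F2 ` ball (w p) r)"
      "inj_on F2 (ball (w p) r)"
    using has_complex_derivative_locally_invertible[OF T(3,2,1) F3_nonzero[OF assms]] .
  obtain V where V: "V holomorphic_on F2 ` ball (w p) r"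
      "\<And>z. z \<in> ball (w p) r \<Longrightarrow> deriv F2 z * deriv V (F2 z) = 1"
      "\<And>z. z \<in> ball (w p) r \<Longrightarrow> V (F2 z) = z"
    using holomorphic_has_inverse[OF holomorphic_on_subset[OF T(3) r(2)] open_ball r(4)]
    by metis
  have "(V has_field_derivative 1 / deriv F2 z) (at (F2 z))" if z: "z \<in> ball (w p) r" for z
  proof -
    have "(V has_field_derivative deriv V (F2 z)) (at (F2 z))"
      using holomorphic_derivI[OF V(1) r(3)] z by blast
    moreover have "deriv V (F2 z) = 1 / deriv F2 z"
      using V(2)[OF z] by (metis divide_eq_eq mult.commute mult_zero_left zero_neq_one)
    ultimately show ?thesis by simp
  qed
  with V(3) r show ?thesis by (intro that[of "ball (w p) r" V]) auto
qed

text \<open>Since \<open>exp (4 \<beta>) = F''(w)\<close>, the coordinate \<open>w\<close> is locally a holomorphic function \<open>W\<close> of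
  \<open>\<beta> = a + c log u\<close> alone, which gives the dependence of \<open>\<zeta> = Z(a, u)\<close> on \<open>u\<close> explicitly.\<close>

lemma Z_chart:
  assumes p: "(\<zeta>, u, v) \<in> M"
  obtains N W where "open N" "(a \<zeta> u, u) \<in> N" "W (beta (\<zeta>, u, v)) = w (\<zeta>, u, v)"
    "\<And>b t. (b, t) \<in> N \<Longrightarrow> t > 0"
    "\<And>b t. (b, t) \<in> N \<Longrightarrow> Z b t = upow ik t * W (b + c * of_real (ln t))"
    "\<And>b t. (b, t) \<in> N \<Longrightarrow> (Z b t, t, v) \<in> M \<and> a (Z b t) t = b"
    "\<And>b t. (b, t) \<in> N \<Longrightarrow> (W has_field_derivative q (W (b + c * of_real (ln t))))
        (at (b + c * of_real (ln t)))"
proof -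
  let ?p = "(\<zeta>, u, v)"
  obtain D V where D: "open D" "w ?p \<in> D" "open (F2 ` D)" "\<And>z. z \<in> D \<Longrightarrow> V (F2 z) = z"
    "\<And>z. z \<in> D \<Longrightarrow> (V has_field_derivative 1 / deriv F2 z) (at (F2 z))"
    using F2_local_inverse[OF p] by metis
  define W where "W b = V (exp (4 * b))" for b
  \<comment> \<open>Radius 1/2 becomes 2 < pi after multiplication by 4, so b is determined by exp
    (4 b) in this ball.\<close>
  define S where "S = ball (beta ?p) (1/2) \<inter> (\<lambda>b. exp (4 * b)) -` (F2 ` D)"
  have openS: "open S" unfolding S_def
    by (intro open_Int open_ball open_vimage D continuous_intros)
  have \<beta>S: "beta ?p \<in> S" using D(2) by (auto simp: S_def exp_4_beta[OF p])
  have W: "W b \<in> D" "F2 (W b) = exp (4 * b)" if "b \<in> S" for b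
    using that D(4) by (auto simp: S_def W_def)
  have Wp: "W (beta ?p) = w ?p" using D(2,4) by (simp add: W_def exp_4_beta[OF p])
  have W_deriv: "(W has_field_derivative q (W b)) (at b)" if b: "b \<in> S" for b
  proof -
    have "(V has_field_derivative 1 / deriv F2 (W b)) (at (exp (4 * b)))"
      using D(5)[OF W(1)[OF b]] W(2)[OF b] by simp
    moreover have "((\<lambda>b. exp (4 * b)) has_field_derivative 4 * exp (4 * b)) (at b)"
      by (auto intro!: derivative_eq_intros)
    ultimately have "((\<lambda>b. V (exp (4 * b))) has_field_derivative
        1 / deriv F2 (W b) * (4 * exp (4 * b))) (at b)"
      by (rule DERIV_chain2)
    then show ?thesis by (simp add: W_def[abs_def] q_def W(2)[OF b, unfolded W_def])
  qed
  have exp_inj: "b = b'" if "exp (4 * b) = exp (4 * b')" "b \<in> ball (beta ?p) (1/2)"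
      "b' \<in> ball (beta ?p) (1/2)" for b b'
  proof -
    have "4 * d \<in> ball (4 * beta ?p) pi" if "d \<in> ball (beta ?p) (1/2)" for d
    proof -
      have "dist (4 * beta ?p) (4 * d) = 4 * dist (beta ?p) d"
        unfolding dist_norm right_diff_distrib[symmetric] norm_mult by simp
      moreover have "dist (beta ?p) d < 1 / 2" using that by simp
      ultimately have "dist (4 * beta ?p) (4 * d) < pi" using pi_gt3 by linarith
      then show ?thesis by simp
    qed
    then have "4 * b = 4 * b'"
      using inj_onD[OF inj_on_exp_pi that(1)] that(2,3) by blast
    then show ?thesis by simp
  qed
  \<comment> \<open>Candidate for the point with coordinates (a, u) = y; \<open>N\<close> below is
    chosen so that it lies in \<open>M\<close> and its \<open>beta\<close> stays in the
    ball.\<close>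
  define \<Phi> where "\<Phi> y = (upow ik (snd y) * W (fst y + c * of_real (ln (snd y))), snd y, v)"
    for y :: "complex \<times> real"
  define \<beta>' where "\<beta>' y = fst y + c * of_real (ln (snd y))" for y :: "complex \<times> real"
  have u: "u > 0" using u_pos p by blast
  have \<beta>'_u: "\<beta>' (a \<zeta> u, u) = beta ?p" by (simp add: \<beta>'_def beta_def)
  have cont_\<beta>': "isCont \<beta>' (a \<zeta> u, u)"
    unfolding \<beta>'_def[abs_def] using u by (intro continuous_intros) auto
  have cont_\<Phi>: "isCont \<Phi> (a \<zeta> u, u)"
  proof -
    have "isCont W (beta ?p)" using W_deriv[OF \<beta>S] DERIV_isCont by blast
    then have "isCont (\<lambda>y. W (\<beta>' y)) (a \<zeta> u, u)"
      by (intro isCont_o2[OF cont_\<beta>']) (simp add: \<beta>'_u)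
    moreover have "isCont (\<lambda>y :: complex \<times> real. upow ik (snd y)) (a \<zeta> u, u)"
      unfolding upow_def using u by (intro continuous_intros) auto
    ultimately show ?thesis
      unfolding \<Phi>_def[abs_def] \<beta>'_def by (intro continuous_intros) auto
  qed
  have \<Phi>_u: "\<Phi> (a \<zeta> u, u) = ?p"
    using \<beta>'_u Wp by (simp add: \<Phi>_def \<beta>'_def w_def upow_minus)
  have "\<forall>\<^sub>F y in nhds (a \<zeta> u, u). \<beta>' y \<in> S"
    using cont_\<beta>' openS \<beta>S \<beta>'_u by (metis isCont_def tendsto_nhds_iff topological_tendstoD)
  moreover have "\<forall>\<^sub>F y in nhds (a \<zeta> u, u). \<Phi> y \<in> M \<and> beta (\<Phi> y) \<in> ball (beta ?p) (1/2)"
  proof -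
    have "isCont (\<lambda>y. beta (\<Phi> y)) (a \<zeta> u, u)"
      by (intro isCont_o2[OF cont_\<Phi>]) (simp add: \<Phi>_u isCont_beta[OF p])
    then have "\<forall>\<^sub>F y in nhds (a \<zeta> u, u). beta (\<Phi> y) \<in> ball (beta ?p) (1/2)"
      by (intro topological_tendstoD[where l = "beta ?p"])
        (auto simp: isCont_def tendsto_nhds_iff \<Phi>_u)
    moreover have "\<forall>\<^sub>F y in nhds (a \<zeta> u, u). \<Phi> y \<in> M"
      using cont_\<Phi> p \<Phi>_u
      by (intro topological_tendstoD[OF _ open_domain, where l = ?p])
        (auto simp: isCont_def tendsto_nhds_iff)
    ultimately show ?thesis by eventually_elim blast
  qed
  ultimately have "\<forall>\<^sub>F y in nhds (a \<zeta> u, u).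
      \<beta>' y \<in> S \<and> \<Phi> y \<in> M \<and> beta (\<Phi> y) \<in> ball (beta ?p) (1/2)"
    by eventually_elim blast
  then obtain N where N: "open N" "(a \<zeta> u, u) \<in> N"
      "\<And>y. y \<in> N \<Longrightarrow> \<beta>' y \<in> S \<and> \<Phi> y \<in> M \<and> beta (\<Phi> y) \<in> ball (beta ?p) (1/2)"
    by (auto simp: eventually_nhds)
  have pos: "t > 0" if "(b, t) \<in> N" for b t
    using N(3)[OF that] u_pos by (auto simp: \<Phi>_def)
  \<comment> \<open>The equation for exp (4 beta) leaves a choice of branch, which
    \<open>exp_inj\<close> removes because both values lie in the ball.\<close>
  have a_\<Phi>: "a (fst (\<Phi> (b, t))) t = b" if bt: "(b, t) \<in> N" for b t
  proof -
    have "w (\<Phi> (b, t)) = W (\<beta>' (b, t))"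
      by (simp add: w_def \<Phi>_def \<beta>'_def upow_minus)
    then have "exp (4 * beta (\<Phi> (b, t))) = exp (4 * \<beta>' (b, t))"
      using N(3)[OF bt] W(2) by (simp add: exp_4_beta)
    then have "beta (\<Phi> (b, t)) = \<beta>' (b, t)"
      by (rule exp_inj) (use N(3)[OF bt] in \<open>auto simp: S_def\<close>)
    then show ?thesis by (simp add: beta_def \<beta>'_def \<Phi>_def)
  qed
  have Z: "Z b t = upow ik t * W (b + c * of_real (ln t))" if bt: "(b, t) \<in> N" for b t
    using N(3)[OF bt] a_\<Phi>[OF bt] by (intro Z_eqI) (auto simp: \<Phi>_def)
  show ?thesis
  proof (rule that[OF N(1,2) Wp pos Z])
    fix b t assume bt: "(b, t) \<in> N"
    show "(Z b t, t, v) \<in> M \<and> a (Z b t) t = b"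
      using N(3)[OF bt] a_\<Phi>[OF bt] by (simp add: Z[OF bt] \<Phi>_def)
    show "(W has_field_derivative q (W (b + c * of_real (ln t)))) (at (b + c * of_real (ln t)))"
      using N(3)[OF bt] by (intro W_deriv) (simp add: \<beta>'_def)
  qed
qed

text \<open>Differentiate Z = u^(ik) W(b + c log u) at fixed b with W' = q(W). For \<open>L\<close>,
  lift exp L = Z_a = u^(ik) q(W) through the exponential.\<close>

lemma Z_derivs:
  assumes p: "(\<zeta>, u, v) \<in> M"
  defines "z \<equiv> w (\<zeta>, u, v)" and "b \<equiv> a \<zeta> u"
  shows "Z_u b u = upow ik u / of_real u * (ik * z + c * q z)"
    and "Z_uu b u = upow ik u / (of_real u)\<^sup>2 *
      ((ik - 1) * (ik * z + c * q z) + c * (ik * q z + c * deriv q z * q z))"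
    and "L_u b u = (ik + c * deriv q z) / of_real u"
proof -
  obtain N W where N: "open N" "(b, u) \<in> N" and Wp: "W (beta (\<zeta>, u, v)) = z"
    and pos: "\<And>b t. (b, t) \<in> N \<Longrightarrow> t > 0"
    and Z: "\<And>b t. (b, t) \<in> N \<Longrightarrow> Z b t = upow ik t * W (b + c * of_real (ln t))"
    and ZM: "\<And>b t. (b, t) \<in> N \<Longrightarrow> (Z b t, t, v) \<in> M \<and> a (Z b t) t = b"
    and W: "\<And>b t. (b, t) \<in> N \<Longrightarrow> (W has_field_derivative q (W (b + c * of_real (ln t))))
        (at (b + c * of_real (ln t)))"
    using Z_chart[OF p] unfolding z_def b_def by metis
  define V where "V t = W (b + c * of_real (ln t))" for t
  have u: "u > 0" using pos N by blast
  have Vu: "V u = z" using Wp by (simp add: V_def b_def beta_def)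
  have ev_b: "\<forall>\<^sub>F b' in nhds b'. (b', t) \<in> N" if "(b', t) \<in> N" for b' t
    using eventually_nhds_in_open[OF open_vimage[OF N(1), of "\<lambda>b. (b, t)"], of b'] that
    by (simp add: continuous_on_Pair)
  have ev_t: "\<forall>\<^sub>F t in nhds t. (b, t) \<in> N" if "(b, t) \<in> N" for t
    using eventually_nhds_in_open[OF open_vimage[OF N(1), of "\<lambda>t. (b, t)"], of t] that
    by (simp add: continuous_on_Pair)
  have dV: "(V has_vector_derivative c / of_real t * q (V t)) (at t)" if t: "(b, t) \<in> N" for t
  proof -
    have "((\<lambda>t. b + c * of_real (ln t)) has_vector_derivative c / of_real t) (at t)"
      using pos[OF t] by (auto intro!: derivative_eq_intros
          simp: has_vector_derivative_def scaleR_conv_of_real field_simps)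
    from field_vector_diff_chain_at[OF this W[OF t]] show ?thesis
      by (simp add: V_def[abs_def] o_def)
  qed
  have dq: "(q has_field_derivative deriv q (V u)) (at (V u))"
    using analytic_DERIV[OF q_analytic(1) p] by (simp add: Vu z_def)
  have dqV: "((\<lambda>t. q (V t)) has_vector_derivative c / of_real u * q z * deriv q z) (at u)"
    using field_vector_diff_chain_at[OF dV[OF N(2)] dq] by (simp add: o_def Vu)
  have Zu: "Z_u b t = upow (ik - 1) t * (ik * V t + c * q (V t))" if t: "(b, t) \<in> N" for t
    unfolding Z_u_def
  proof (rule vector_derivative_at, rule has_vector_derivative_cong_nhds)
    show "((\<lambda>t. upow ik t * V t) has_vector_derivative
        upow (ik - 1) t * (ik * V t + c * q (V t))) (at t)"
      using has_vector_derivative_mult[OF has_vector_derivative_upow[OF pos[OF t]] dV[OF t], of ik]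
        pos[OF t] unfolding upow_diff[of ik] by (simp add: upow_minus upow_1 field_simps)
    show "\<forall>\<^sub>F t in nhds t. upow ik t * V t = Z b t"
      using ev_t[OF t] by eventually_elim (simp add: Z V_def)
  qed
  show "Z_u b u = upow ik u / of_real u * (ik * z + c * q z)"
    using u by (simp add: Zu[OF N(2)] Vu upow_diff[of ik] upow_minus upow_1 field_simps)
  have lin: "((\<lambda>t. ik * V t + c * q (V t)) has_vector_derivative
      (ik * (c / of_real u * q z) + c * (c / of_real u * q z * deriv q z))) (at u)"
    using dV[OF N(2)] dqV
    by (intro has_vector_derivative_add has_vector_derivative_mult_right) (auto simp: Vu)
  show "Z_uu b u = upow ik u / (of_real u)\<^sup>2 *
      ((ik - 1) * (ik * z + c * q z) + c * (ik * q z + c * deriv q z * q z))"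
    unfolding Z_uu_def
  proof (rule vector_derivative_at, rule has_vector_derivative_cong_nhds)
    have "upow (ik - 1) u * (ik * (c / of_real u * q z) + c * (c / of_real u * q z * deriv q z))
        + (ik - 1) / of_real u * upow (ik - 1) u * (ik * V u + c * q (V u))
      = upow ik u / (of_real u)\<^sup>2 *
        ((ik - 1) * (ik * z + c * q z) + c * (ik * q z + c * deriv q z * q z))"
      using u by (simp add: Vu upow_diff[of ik] upow_minus upow_1 field_simps power2_eq_square)
    then show "((\<lambda>t. upow (ik - 1) t * (ik * V t + c * q (V t))) has_vector_derivative
        upow ik u / (of_real u)\<^sup>2 *
        ((ik - 1) * (ik * z + c * q z) + c * (ik * q z + c * deriv q z * q z))) (at u)"
      using has_vector_derivative_mult[OF has_vector_derivative_upow[OF u] lin, of "ik - 1"]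
      by simp
    show "\<forall>\<^sub>F t in nhds u. upow (ik - 1) t * (ik * V t + c * q (V t)) = Z_u b t"
      using ev_t[OF N(2)] by eventually_elim (simp add: Zu)
  qed
  \<comment> \<open>\<open>L_branch\<close> speaks only of pairs (a, u) attained on
    \<open>M\<close>; \<open>ZM\<close> shows that every pair in \<open>N\<close> is
    attained.\<close>
  have expL: "exp (L b t) = upow ik t * q (V t)" if t: "(b, t) \<in> N" for t
  proof -
    have "exp (L (a (Z b t) t) t) = deriv (\<lambda>b. Zinv M a b t) (a (Z b t) t)"
      by (rule L_branch) (use ZM[OF t] in blast)
    then have "exp (L b t) = deriv (\<lambda>b. Z b t) b"
      using ZM[OF t] by (simp add: Z_def)
    also have "\<dots> = deriv (\<lambda>b. upow ik t * W (b + c * of_real (ln t))) b"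
      by (rule deriv_cong_ev) (use ev_b[OF t] in \<open>auto elim: eventually_mono simp: Z\<close>)
    also have "\<dots> = upow ik t * q (V t)"
      using W[OF t] by (intro DERIV_imp_deriv)
        (auto intro!: derivative_eq_intros DERIV_chain2[where f = W] simp: V_def)
    finally show ?thesis .
  qed
  have "continuous_on {t. (b, t) \<in> N} (\<lambda>t. (\<lambda>(b, u). L b u) (b, t))"
  proof (rule continuous_on_compose2[OF L_continuous])
    show "(\<lambda>t. (b, t)) ` {t. (b, t) \<in> N} \<subseteq> (\<lambda>(\<zeta>, u). (a \<zeta> u, u)) ` base_proj ` M"
    proof safe
      fix t assume "(b, t) \<in> N"
      then have "(Z b t, t) \<in> base_proj ` M" "a (Z b t) t = b"
        using ZM by (force simp: base_proj_def)+
      then show "(b, t) \<in> (\<lambda>(\<zeta>, u). (a \<zeta> u, u)) ` base_proj ` M"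
        by (metis (no_types, lifting) image_eqI case_prod_conv)
    qed
  qed (intro continuous_intros)
  moreover have "open {t. (b, t) \<in> N}"
    using open_vimage[OF N(1), of "\<lambda>t. (b, t)"] by (simp add: vimage_def continuous_intros)
  ultimately have contL: "isCont (L b) u"
    using N(2) by (simp add: continuous_on_eq_continuous_at)
  have "((\<lambda>t. upow ik t * q (V t)) has_vector_derivative
      upow ik u * q z * ((ik + c * deriv q z) / of_real u)) (at u)"
    using has_vector_derivative_mult[OF has_vector_derivative_upow[OF u] dqV, of ik] u
    by (simp add: Vu field_simps)
  then have "(L b has_derivative (\<lambda>x. x *\<^sub>R (upow ik u * q z * ((ik + c * deriv q z) / of_real u))
      / (upow ik u * q (V u)))) (at u)"
    unfolding has_vector_derivative_def
    by (rule has_derivative_exp_lift[OF contL, rotated])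
      (use ev_t[OF N(2)] in \<open>auto elim: eventually_mono simp: expL\<close>)
  then have "(L b has_vector_derivative (ik + c * deriv q z) / of_real u) (at u)"
    unfolding has_vector_derivative_def
    by (rule has_derivative_eq_rhs)
      (use q_nonzero[OF p] in \<open>simp add: fun_eq_iff Vu z_def scaleR_conv_of_real\<close>)
  then show "L_u b u = (ik + c * deriv q z) / of_real u"
    unfolding L_u_def by (rule vector_derivative_at)
qed

section \<open>Closed forms of \<open>alpha\<close>, \<open>mu\<close> and \<open>nu\<close>\<close>

definition E :: "point \<Rightarrow> complex" where "E p = exp (beta p)"

text \<open>Since c + cnj c = 1, on \<open>M\<close> the product of h and u is exp (- a - cnj a),
  the factor in \<open>mu\<close> and \<open>Delta\<close>.\<close>

definition h :: "point \<Rightarrow> complex" where "h p = 1 / (E p * cnj (E p))"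

lemma E_nonzero [simp]: "E p \<noteq> 0"
  by (simp add: E_def)

lemma h_nonzero [simp]: "h p \<noteq> 0"
  by (simp add: h_def)

lemma cnj_h [simp]: "cnj (h p) = h p"
  by (simp add: h_def)

lemma exp_a:
  shows "exp (a \<zeta> u) = E (\<zeta>, u, v) * upow (- c) u"
    and "exp (cnj (a \<zeta> u)) = cnj (E (\<zeta>, u, v)) * upow (c - 1) u"
proof -
  show 1: "exp (a \<zeta> u) = E (\<zeta>, u, v) * upow (- c) u"
    by (simp add: E_def beta_def upow_def flip: exp_add)
  have "exp (cnj (a \<zeta> u)) = cnj (exp (a \<zeta> u))" by (simp add: exp_cnj)
  then show "exp (cnj (a \<zeta> u)) = cnj (E (\<zeta>, u, v)) * upow (c - 1) u"
    by (simp add: 1 cnj_upow cnj_c)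
qed

lemma exp_a_diff:
  shows "exp (a \<zeta> u - cnj (a \<zeta> u)) = E (\<zeta>, u, v) / cnj (E (\<zeta>, u, v)) * upow (- ik) u"
proof -
  have "upow (- c) u / upow (c - 1) u = upow (- ik) u"
    using upow_add[of "- ik" "c - 1" u] by (simp add: ik_eq)
  then show ?thesis
    by (simp add: exp_diff exp_a[of _ _ v] flip: times_divide_times_eq)
qed

lemma exp_a_sum:
  assumes "u > 0"
  shows "exp (a \<zeta> u + cnj (a \<zeta> u)) = 1 / (h (\<zeta>, u, v) * of_real u)"
proof -
  have "upow (- c) u * upow (c - 1) u = upow (- 1) u"
    by (simp flip: upow_add)
  also have "\<dots> = 1 / of_real u"
    using assms by (simp add: upow_minus upow_1 divide_inverse)
  finally have "upow (- c) u * upow (c - 1) u = 1 / of_real u" .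
  moreover have "exp (a \<zeta> u + cnj (a \<zeta> u))
      = E (\<zeta>, u, v) * cnj (E (\<zeta>, u, v)) * (upow (- c) u * upow (c - 1) u)"
    by (simp only: exp_add exp_a[of _ _ v] mult_ac)
  ultimately show ?thesis by (simp add: h_def)
qed

text \<open>The exponents of u collect to c - 3 (c - 1) = 3 - 2 c = 2 - ik.\<close>

lemma exp_a_nu:
  shows "exp (- a \<zeta> u - 3 * cnj (a \<zeta> u))
    = upow (2 - ik) u / (E (\<zeta>, u, v) * cnj (E (\<zeta>, u, v)) ^ 3)"
proof -
  have "upow (c - 1) u ^ 3 = upow (3 * (c - 1)) u"
    unfolding upow_def by (simp only: mult.assoc exp_of_nat_mult[of 3, simplified])
  then have "upow (2 - ik) u * (upow (- c) u * upow (c - 1) u ^ 3) = 1"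
    by (simp add: ik_eq algebra_simps flip: upow_add)
  then have 1: "upow (2 - ik) u = 1 / (upow (- c) u * upow (c - 1) u ^ 3)"
    by (simp add: nonzero_eq_divide_eq)
  have "exp (- a \<zeta> u - 3 * cnj (a \<zeta> u)) = 1 / (exp (a \<zeta> u) * exp (cnj (a \<zeta> u)) ^ 3)"
    using exp_of_nat_mult[of 3 "cnj (a \<zeta> u)"]
    by (simp add: exp_diff exp_minus divide_inverse)
  also have "exp (a \<zeta> u) * exp (cnj (a \<zeta> u)) ^ 3
      = (upow (- c) u * upow (c - 1) u ^ 3) * (E (\<zeta>, u, v) * cnj (E (\<zeta>, u, v)) ^ 3)"
    by (simp only: exp_a[of _ _ v] power_mult_distrib mult_ac)
  finally show ?thesis unfolding 1 by (simp only: divide_divide_eq_left)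
qed

lemma F2_eq_E: "p \<in> M \<Longrightarrow> F2 (w p) = E p ^ 4"
  using exp_of_nat_mult[of 4 "beta p"] by (simp add: E_def flip: exp_4_beta)

text \<open>The power u^(-ik) from exp (a - cnj a) cancels against the conjugate of the one in
  a_zeta.\<close>

lemma alpha_eq:
  assumes "p \<in> M" shows "alpha p = E p / cnj (E p * q (w p))"
proof -
  obtain \<zeta> u v where p: "p = (\<zeta>, u, v)" by (cases p)
  show ?thesis
    using assms by (simp add: p alpha_def a_zeta exp_a_diff[of _ _ v] cnj_upow upow_minus mult.commute)
qed

lemma mu_eq:
  assumes "p \<in> M" shows "mu p = h p * (ik + c * deriv q (w p))"
proof -
  obtain \<zeta> u v where p: "p = (\<zeta>, u, v)" by (cases p)
  have u: "u > 0" using assms u_pos p by blast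
  have "exp (- a \<zeta> u - cnj (a \<zeta> u)) = inverse (exp (a \<zeta> u + cnj (a \<zeta> u)))"
    by (simp flip: exp_minus)
  then show ?thesis
    using assms u by (simp add: p mu_def Z_derivs exp_a_sum[of _ _ v])
qed

text \<open>The prefactor u^(2 - ik) cancels the power u^(ik - 2), which occurs both in Z_uu and in
  the conjugate of f_zeta. Apart from \<open>w\<close> and \<open>E\<close>, u survives only in
  \<open>g\<close>.\<close>

lemma nu_eq:
  assumes "p \<in> M"
  shows "nu p = ((ik - 1) * (ik * w p + c * q (w p))
      + c * (ik * q (w p) + c * deriv q (w p) * q (w p))
      + cnj (deriv F (w p) + g (fst (snd p)))) / (E p * cnj (E p) ^ 3)"
proof -
  obtain \<zeta> u v where p: "p = (\<zeta>, u, v)" by (cases p)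
  have u: "u > 0" using assms u_pos p by blast
  have "upow 2 u = (of_real u)\<^sup>2"
    using upow_add[of 1 1 u] u by (simp add: upow_1 power2_eq_square)
  then have 1: "upow (2 - ik) u * (upow ik u / (of_real u)\<^sup>2) = 1"
    using u by (simp add: upow_diff upow_minus)
  have 2: "upow (2 - ik) u * cnj (upow (- 2 - ik) u) = 1"
    by (simp add: cnj_upow flip: upow_add)
  define Y where "Y = (ik - 1) * (ik * w p + c * q (w p))
      + c * (ik * q (w p) + c * deriv q (w p) * q (w p))"
  have "nu p = upow (2 - ik) u / (E p * cnj (E p) ^ 3) *
      (upow ik u / (of_real u)\<^sup>2 * Y
       + cnj (upow (- 2 - ik) u) * cnj (deriv F (w p) + g u))"
    using assms u by (simp add: p nu_def Z_derivs exp_a_nu[of _ _ v] f_zeta Y_def)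
  also have "\<dots> = (upow (2 - ik) u * (upow ik u / (of_real u)\<^sup>2) * Y
       + upow (2 - ik) u * cnj (upow (- 2 - ik) u) * cnj (deriv F (w p) + g u))
      / (E p * cnj (E p) ^ 3)"
  proof -
    have "x / y * (r * z + s * t) = (x * r * z + x * s * t) / y" for x y r s t z :: complex
      by (simp add: distrib_left mult.assoc add_divide_distrib)
    then show ?thesis .
  qed
  finally show ?thesis
    unfolding 1 2 Y_def by (simp add: p)
qed

section \<open>Differentials in the coframe and frame derivatives\<close>

lemma du_coframe:
  assumes "p \<in> M"
  shows "of_real (fst (snd x)) = h p * of_real (fst (snd p)) * \<omega>3 p x"
proof -
  obtain \<zeta> u v where p: "p = (\<zeta>, u, v)" by (cases p)
  obtain x1 x2 x3 where x: "x = (x1, x2, x3)" by (cases x)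
  have u: "u > 0" using assms u_pos p by blast
  show ?thesis using u by (simp add: p x \<omega>3_def exp_a_sum[OF u, of _ v])
qed

text \<open>This is dbeta = da + c du/u with da = cnj alpha omega1 and du/u = h omega3; the formula
  for Z_u verifies the first of these.\<close>

lemma dbeta_coframe:
  assumes "p \<in> M"
  shows "dbeta p x = cnj (alpha p) * \<omega>1 p x + c * h p * \<omega>3 p x"
proof -
  obtain \<zeta> u v where p: "p = (\<zeta>, u, v)" by (cases p)
  obtain x1 x2 x3 where x: "x = (x1, x2, x3)" by (cases x)
  have u: "u > 0" using assms u_pos p by blast
  have w3: "h p * \<omega>3 p x = of_real x2 / of_real u"
    using du_coframe[OF assms, of x] u by (simp add: p x field_simps)
  have "cnj (alpha p) * \<omega>1 p x = cnj (E p) / (E p * q (w p)) *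
      (E p / cnj (E p) * upow (- ik) u
        * (x1 - upow ik u / of_real u * (ik * w p + c * q (w p)) * of_real x2))"
    using assms u by (simp add: alpha_eq) (simp add: p x \<omega>1_def Z_derivs exp_a_diff[of _ _ v])
  also have "\<dots> = (upow (- ik) u * x1 - (ik * w p + c * q (w p)) / of_real u * of_real x2)
      / q (w p)"
    using u q_nonzero[OF assms] by (simp add: upow_minus field_simps)
  finally have 1: "cnj (alpha p) * \<omega>1 p x = \<dots>" .
  have "dbeta p x = \<dots> + c * (of_real x2 / of_real u)"
    using u q_nonzero[OF assms] by (simp add: dbeta_def dw_def p x field_simps)
  then show ?thesis
    unfolding 1[symmetric] w3[symmetric] by (simp add: mult.assoc)
qed

lemma differential_eq: "(Q has_derivative D) (at p) \<Longrightarrow> differential Q p = D"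
  unfolding differential_def using frechet_derivative_at by metis

text \<open>Reduces every frame derivative to reading off three coefficients; nothing here depends
  on v, so the last component is zero.\<close>

lemma frame_derivs_eq:
  assumes "p \<in> M" and "(Q has_derivative (\<lambda>x. q1 * dbeta p x + q2 * cnj (dbeta p x)
      + q3 * of_real (fst (snd x)))) (at p)"
  shows "frame_derivs Q p = (q1 * cnj (alpha p), q2 * alpha p,
      h p * (q1 * c + q2 * cnj c + q3 * of_real (fst (snd p))), 0)"
proof (rule frame_derivs_eqI)
  fix x
  have "cnj (\<omega>3 p x) = \<omega>3 p x"
    by (cases p; cases x) (simp add: \<omega>3_def exp_cnj add.commute)
  then show "differential Q p x = q1 * cnj (alpha p) * \<omega>1 p x + q2 * alpha p * \<omega>2 p x
      + h p * (q1 * c + q2 * cnj c + q3 * of_real (fst (snd p))) * \<omega>3 p x + 0 * \<omega>4 p x"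
    unfolding differential_eq[OF assms(2)] du_coframe[OF assms(1), of x] dbeta_coframe[OF assms(1)]
    by (simp add: \<omega>2_def algebra_simps)
qed

lemma has_derivative_holomorphic_w:
  assumes "G analytic_on w ` M" "p \<in> M"
  shows "((\<lambda>p. G (w p)) has_derivative (\<lambda>x. deriv G (w p) * q (w p) * dbeta p x)) (at p)"
proof -
  have "((\<lambda>p. G (w p)) has_derivative (\<lambda>x. deriv G (w p) * dw p x)) (at p)"
    using analytic_DERIV[OF assms]
    by (intro has_derivative_compose[OF has_derivative_w[OF assms(2)]])
      (simp add: has_field_derivative_def)
  then show ?thesis using q_nonzero[OF assms(2)] by (simp add: dbeta_def)
qed

lemma has_derivative_E_power:
  assumes "p \<in> M"
  shows "((\<lambda>p. E p powi n) has_derivative (\<lambda>x. of_int n * E p powi n * dbeta p x)) (at p)"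
proof -
  have "((\<lambda>b. exp (of_int n * b)) has_field_derivative of_int n * E p powi n) (at (beta p))"
    by (rule derivative_eq_intros refl)+ (simp add: E_def exp_power_int mult.commute)
  from has_derivative_compose[OF has_derivative_beta[OF assms] this[unfolded has_field_derivative_def]]
  show ?thesis by (simp add: E_def exp_power_int)
qed

text \<open>Write alpha as E times the conjugate of 1/(E q); the conjugate factor yields the term
  with 1 + cnj q'. The zero du term fits the form of \<open>frame_derivs_eq\<close>.\<close>

lemma has_derivative_alpha:
  assumes "p \<in> M"
  shows "(alpha has_derivative (\<lambda>x. alpha p * dbeta p x
      + - (1 + cnj (deriv q (w p))) * alpha p * cnj (dbeta p x) + 0 * of_real (fst (snd x)))) (at p)"
proof (rule has_derivative_cong_nhds)
  show "\<forall>\<^sub>F p in nhds p. E p powi 1 * cnj (E p powi (- 1) * (1 / q (w p))) = alpha p"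
    using eventually_nhds_in_open[OF open_domain assms]
    by eventually_elim (simp add: alpha_eq power_int_minus divide_inverse)
  have "((\<lambda>p. 1 / q (w p)) has_derivative
      (\<lambda>x. - (deriv q (w p) / q (w p) * dbeta p x))) (at p)"
    using has_derivative_divide[OF has_derivative_const[of 1]
        has_derivative_holomorphic_w[OF q_analytic(1) assms] q_nonzero[OF assms]]
    by (rule has_derivative_eq_rhs) (simp add: fun_eq_iff q_nonzero[OF assms] field_simps)
  note D = has_derivative_mult[OF has_derivative_E_power[OF assms, of 1]
      has_derivative_cnj[OF has_derivative_mult[OF has_derivative_E_power[OF assms, of "-1"] this]]]
  show "((\<lambda>p. E p powi 1 * cnj (E p powi (- 1) * (1 / q (w p)))) has_derivative
     (\<lambda>x. alpha p * dbeta p x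
      + - (1 + cnj (deriv q (w p))) * alpha p * cnj (dbeta p x) + 0 * of_real (fst (snd x)))) (at p)"
  proof (rule has_derivative_eq_rhs[OF D], rule ext)
    fix x
    show "E p powi 1 * cnj (E p powi (- 1) * - (deriv q (w p) / q (w p) * dbeta p x)
          + of_int (- 1) * E p powi (- 1) * dbeta p x * (1 / q (w p)))
        + of_int 1 * E p powi 1 * dbeta p x * cnj (E p powi (- 1) * (1 / q (w p)))
      = alpha p * dbeta p x
      + - (1 + cnj (deriv q (w p))) * alpha p * cnj (dbeta p x) + 0 * of_real (fst (snd x))"
      using q_nonzero[OF assms] by (simp add: alpha_eq[OF assms] power_int_minus field_simps)
  qed
qed

lemma A_eq: "p \<in> M \<Longrightarrow> A p = - (1 + cnj (deriv q (w p)))"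
  using frame_derivs_eq[OF _ has_derivative_alpha] alpha_nonzero
  by (simp add: A_def delta_star_def power2_eq_square)

text \<open>By \<open>A_eq\<close>, mu = - h (cnj c + c cnj A), so the terms linear in A cancel in
  mu A - cnj mu and leave - c h (A cnj A - 1).\<close>

lemma X_eq:
  assumes "p \<in> M"
  shows "X p = - c * h p"
proof -
  have "B p = - c * h p * (A p * cnj (A p) - 1)"
    unfolding B_def mu_eq[OF assms] A_eq[OF assms]
    by (simp add: cnj_c ik_eq algebra_simps)
  then show ?thesis using A_nondegenerate[OF assms] by (simp add: X_def)
qed

section \<open>Differentiability of \<open>g\<close>\<close>

text \<open>Smoothness is assumed of \<open>f\<close> only; solving the form of \<open>f\<close> for
  g at a fixed nonzero zeta transfers differentiability.\<close>

lemma has_vector_derivative_g: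
  assumes "p \<in> M"
  shows "(g has_vector_derivative vector_derivative g (at (fst (snd p)))) (at (fst (snd p)))"
proof -
  obtain \<zeta>0 u v where p: "p = (\<zeta>0, u, v)" by (cases p)
  \<comment> \<open>The zeta-slice of \<open>M\<close> is open, so the point can be moved to nonzero
    zeta with the same u.\<close>
  have "\<forall>\<^sub>F z in at \<zeta>0. (z, u, v) \<in> M"
    using eventually_slice_zeta[of \<zeta>0 u v] assms
    by (simp add: p eventually_at_filter eventually_mono)
  then have "\<forall>\<^sub>F z in at \<zeta>0. (z, u, v) \<in> M \<and> z \<noteq> 0"
    by (intro eventually_conj eventually_neq_at_within)
  then obtain \<zeta> where \<zeta>: "(\<zeta>, u, v) \<in> M" "\<zeta> \<noteq> 0"
    using eventually_happens'[OF at_neq_bot] by blast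
  have u: "u > 0" using u_pos \<zeta> by blast
  \<comment> \<open>Order 0 in \<open>smooth_on\<close> already asserts differentiability of the
    function itself.\<close>
  have "((\<lambda>t. f \<zeta> t) differentiable at u)"
    using f_smooth[of \<zeta>, unfolded smooth_on_def, rule_format, of u 0] \<zeta> by auto
  then obtain f' where f': "((\<lambda>t. f \<zeta> t) has_vector_derivative f') (at u)"
    using vector_derivative_works by blast
  have 1: "((\<lambda>t. upow (- ik) t * \<zeta>) has_vector_derivative
      (- ik / of_real u * upow (- ik) u) * \<zeta>) (at u)"
    by (intro has_vector_derivative_mult_left has_vector_derivative_upow u)
  have "(F has_field_derivative deriv F (w (\<zeta>, u, v))) (at (upow (- ik) u * \<zeta>))"
    using analytic_DERIV[OF F_analytic' \<zeta>(1)] by (simp add: w_def)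
  from field_vector_diff_chain_at[OF 1 this]
  obtain F' where F': "((\<lambda>t. F (upow (- ik) t * \<zeta>)) has_vector_derivative F') (at u)"
    by (auto simp: o_def)
  note D = has_vector_derivative_mult[OF
      has_vector_derivative_diff[OF f'
        has_vector_derivative_mult[OF F' has_vector_derivative_upow[OF u, of "- 2"]]]
      has_vector_derivative_divide[OF has_vector_derivative_upow[OF u, of "2 + ik"], of \<zeta>]]
  have "\<exists>D. (g has_vector_derivative D) (at u)"
  proof (rule exI, rule has_vector_derivative_cong_nhds[OF D])
    show "\<forall>\<^sub>F t in nhds u. (f \<zeta> t - F (upow (- ik) t * \<zeta>) * upow (- 2) t)
      * (upow (2 + ik) t / \<zeta>) = g t"
      using eventually_slice_u[OF \<zeta>(1)]
    proof eventually_elim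
      case (elim t)
      have "upow (- 2 - ik) t * upow (2 + ik) t = 1"
        by (simp flip: upow_add)
      then show ?case using \<zeta>(2) by (simp add: f_eq'[OF elim])
    qed
  qed
  then show ?thesis by (auto simp: p vector_derivative_at)
qed

definition dg :: "point \<Rightarrow> complex" where "dg p = vector_derivative g (at (fst (snd p)))"

lemma has_derivative_g:
  assumes "p \<in> M"
  shows "((\<lambda>p. g (fst (snd p))) has_derivative (\<lambda>x. dg p * of_real (fst (snd x)))) (at p)"
proof -
  have "((\<lambda>p :: point. fst (snd p)) has_derivative (\<lambda>x. fst (snd x))) (at p)"
    by (intro has_derivative_fst has_derivative_snd has_derivative_ident)
  from has_derivative_compose[OF this has_vector_derivative_g[OF assms,
        unfolded has_vector_derivative_def]] show ?thesis
    by (simp add: scaleR_conv_of_real dg_def mult.commute)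
qed

definition G :: "point \<Rightarrow> complex" where "G p = deriv F (w p) + g (fst (snd p))"

lemma has_derivative_G:
  assumes "p \<in> M"
  shows "(G has_derivative (\<lambda>x. E p ^ 4 * q (w p) * dbeta p x + dg p * of_real (fst (snd x)))) (at p)"
  using has_derivative_add[OF has_derivative_holomorphic_w[OF F_deriv_analytic(1) assms]
      has_derivative_g[OF assms]]
  by (simp add: G_def[abs_def] F2_def[symmetric] F2_eq_E[OF assms])

section \<open>The invariants \<open>nu_hat\<close> and \<open>Upsilon_hat\<close>\<close>

definition nu_ratio :: "point \<Rightarrow> complex" where
  "nu_ratio p = 2 * ik * w p / cnj (E p) ^ 2 - cnj (G p / E p ^ 2) / cnj c"

text \<open>Because ik - 1 = - 2 cnj c, all terms with q and q' in \<open>nu\<close> cancel against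
  those of the correction X (mu + 2 cnj X) / cnj alpha.\<close>

lemma nu_hat_eq:
  assumes "p \<in> M" shows "nu_hat p = cnj (X p) * nu_ratio p"
proof -
  \<comment> \<open>With c and ik expressed through d, the remaining identity is purely
    polynomial.\<close>
  define d where "d = cnj c"
  have d: "d \<noteq> 0" "c = 1 - d" "ik = 1 - 2 * d"
    using cnj_c ik_eq by (auto simp: d_def)
  have "X p * (mu p + 2 * cnj (X p)) / cnj (alpha p)
      = - c * q (w p) * (ik + c * deriv q (w p) - 2 * d) / (E p * cnj (E p) ^ 3)"
    using q_nonzero[OF assms]
    by (simp add: X_eq[OF assms] mu_eq[OF assms] alpha_eq[OF assms] h_def d_def[symmetric])
      (simp add: field_simps power2_eq_square power3_eq_cube)
  then have "nu_hat p = ((ik - 1) * (ik * w p + c * q (w p))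
      + c * (ik * q (w p) + c * deriv q (w p) * q (w p)) + cnj (G p)
      - c * q (w p) * (ik + c * deriv q (w p) - 2 * d)) / (E p * cnj (E p) ^ 3)"
    by (simp only: nu_hat_def nu_eq[OF assms] G_def[symmetric] diff_conv_add_uminus
        add_divide_distrib mult_minus_left minus_divide_left)
  also have "\<dots> = (cnj (G p) - 2 * d * ik * w p) / (E p * cnj (E p) ^ 3)"
    by (simp add: d(2,3) algebra_simps)
  also have "\<dots> = cnj (X p) * nu_ratio p"
    using d(1) by (simp add: X_eq[OF assms] nu_ratio_def h_def d_def[symmetric])
      (simp add: field_simps power2_eq_square power3_eq_cube)
  finally show ?thesis .
qed

lemma has_derivative_nu_ratio:
  assumes "p \<in> M"
  shows "(nu_ratio has_derivative (\<lambda>x. 2 * ik * q (w p) / cnj (E p) ^ 2 * dbeta p x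
      + (- 4 * ik * w p / cnj (E p) ^ 2
         - cnj (E p ^ 2 * q (w p) - 2 * G p / E p ^ 2) / cnj c) * cnj (dbeta p x)
      + - cnj (dg p) / (cnj c * cnj (E p) ^ 2) * of_real (fst (snd x)))) (at p)"
proof -
  have nu_ratio: "nu_ratio = (\<lambda>p. 2 * ik * (w p * cnj (E p powi (- 2)))
      - inverse (cnj c) * cnj (G p * E p powi (- 2)))"
    by (simp add: fun_eq_iff nu_ratio_def power_int_minus divide_inverse)
  have dw: "(w has_derivative (\<lambda>x. q (w p) * dbeta p x)) (at p)"
    using has_derivative_w[OF assms] q_nonzero[OF assms] by (simp add: dbeta_def[abs_def])
  note dE = has_derivative_E_power[OF assms, of "- 2"]
  show ?thesis
    unfolding nu_ratio
  proof (rule has_derivative_eq_rhs[OF has_derivative_diff[OF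
          has_derivative_mult_right[OF has_derivative_mult[OF dw has_derivative_cnj[OF dE]]]
          has_derivative_mult_right[OF has_derivative_cnj[OF
            has_derivative_mult[OF has_derivative_G[OF assms] dE]]]]], rule ext)
    fix x
    show "2 * ik * (w p * cnj (of_int (- 2) * E p powi (- 2) * dbeta p x)
          + q (w p) * dbeta p x * cnj (E p powi (- 2)))
        - inverse (cnj c) * cnj (G p * (of_int (- 2) * E p powi (- 2) * dbeta p x)
          + (E p ^ 4 * q (w p) * dbeta p x + dg p * of_real (fst (snd x))) * E p powi (- 2))
      = 2 * ik * q (w p) / cnj (E p) ^ 2 * dbeta p x
      + (- 4 * ik * w p / cnj (E p) ^ 2
         - cnj (E p ^ 2 * q (w p) - 2 * G p / E p ^ 2) / cnj c) * cnj (dbeta p x)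
      + - cnj (dg p) / (cnj c * cnj (E p) ^ 2) * of_real (fst (snd x))"
      by (simp add: power_int_minus field_simps power2_eq_square power4_eq_xxxx)
  qed
qed

text \<open>In Delta(nu_hat / cnj X) the terms with w and G cancel against - 2 nu_hat, the one with
  cnj q against 1 / alpha, and the one with q against the last summand. Only the explicit
  u-derivative of \<open>g\<close> remains.\<close>

lemma Upsilon_hat_eq:
  assumes "p \<in> M"
  shows "Upsilon_hat p = - h p * of_real (fst (snd p)) * cnj (dg p) / (cnj c * cnj (E p) ^ 2)"
proof -
  define d where "d = cnj c"
  have d: "d \<noteq> 0" "c = 1 - d" "ik = 1 - 2 * d"
    using cnj_c ik_eq by (auto simp: d_def)
  have "\<forall>\<^sub>F p in nhds p. nu_ratio p = nu_hat p / cnj (X p)"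
    using eventually_nhds_in_open[OF open_domain assms]
    by eventually_elim (simp add: nu_hat_eq X_eq)
  from frame_derivs_eq[OF assms has_derivative_cong_nhds[OF has_derivative_nu_ratio[OF assms] this]]
  have Delta: "Delta (\<lambda>p. nu_hat p / cnj (X p)) p
      = h p * (2 * ik * q (w p) / cnj (E p) ^ 2 * c
        + (- 4 * ik * w p / cnj (E p) ^ 2
           - cnj (E p ^ 2 * q (w p) - 2 * G p / E p ^ 2) / d) * d
        + - cnj (dg p) / (d * cnj (E p) ^ 2) * of_real (fst (snd p)))"
    by (simp add: Delta_def d_def)
  \<comment> \<open>Here c - cnj c = ik; the difference is 2 i Im X.\<close>
  have Im_X: "X p - cnj (X p) = - h p * ik"
    by (simp add: X_eq[OF assms] cnj_c ik_eq algebra_simps)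
  have "4 * \<i> * X p * of_real (Im (X p)) = 2 * X p * (X p - cnj (X p))"
    unfolding complex_diff_cnj by simp
  also have "\<dots> = 2 * c * h p ^ 2 * ik"
    unfolding Im_X by (simp add: X_eq[OF assms] power2_eq_square)
  finally have ImX: "4 * \<i> * X p * of_real (Im (X p)) = 2 * c * h p ^ 2 * ik" .
  have "Upsilon_hat p = h p * (2 * ik * q (w p) / cnj (E p) ^ 2 * c
        + (- 4 * ik * w p / cnj (E p) ^ 2
           - cnj (E p ^ 2 * q (w p) - 2 * G p / E p ^ 2) / d) * d
        + - cnj (dg p) / (d * cnj (E p) ^ 2) * of_real (fst (snd p)))
      + 2 * d * h p * (2 * ik * w p / cnj (E p) ^ 2 - cnj (G p / E p ^ 2) / d)
      + cnj (E p * q (w p)) / E p - 2 * c * h p ^ 2 * ik * E p * q (w p) / cnj (E p)"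
    unfolding Upsilon_hat_def Delta ImX nu_hat_eq[OF assms]
    by (simp add: nu_ratio_def alpha_eq[OF assms] X_eq[OF assms] d_def)
  also have "\<dots> = - h p * of_real (fst (snd p)) * cnj (dg p) / (d * cnj (E p) ^ 2)"
    using d(1) unfolding h_def by (simp add: field_simps power2_eq_square)
  finally show ?thesis by (simp add: d_def)
qed

section \<open>The wedge product and the equivalences\<close>

text \<open>Only the du coefficient is made explicit: the other two disappear in the wedge with d
  alpha and its conjugate.\<close>

lemma has_derivative_nu:
  assumes "p \<in> M"
  obtains r1 r2 where "(nu has_derivative (\<lambda>x. r1 * dbeta p x + r2 * cnj (dbeta p x)
      + cnj (dg p) / (E p * cnj (E p) ^ 3) * of_real (fst (snd x)))) (at p)"
proof -
  define Y where "Y z = (ik - 1) * (ik * z + c * q z) + c * (ik * q z + c * deriv q z * q z)" for z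
  have "Y analytic_on w ` M"
    unfolding Y_def[abs_def] by (intro analytic_intros q_analytic)
  note D = has_derivative_mult[OF has_derivative_add[OF
        has_derivative_holomorphic_w[OF this assms] has_derivative_cnj[OF has_derivative_G[OF assms]]]
      has_derivative_mult[OF has_derivative_E_power[OF assms, of "- 1"]
        has_derivative_cnj[OF has_derivative_E_power[OF assms, of "- 3"]]]]
  have ev: "\<forall>\<^sub>F p in nhds p. (Y (w p) + cnj (G p)) * (E p powi (- 1) * cnj (E p powi (- 3))) = nu p"
    using eventually_nhds_in_open[OF open_domain assms]
    by eventually_elim (simp add: nu_eq Y_def G_def power_int_minus divide_inverse)
  define S where "S = Y (w p) + cnj (G p)"
  define e where "e = 1 / (E p * cnj (E p) ^ 3)"
  have "(nu has_derivative (\<lambda>x. (deriv Y (w p) * q (w p) * e - S * e) * dbeta p x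
      + (cnj (E p ^ 4 * q (w p)) * e - 3 * S * e) * cnj (dbeta p x)
      + cnj (dg p) / (E p * cnj (E p) ^ 3) * of_real (fst (snd x)))) (at p)"
  proof (rule has_derivative_eq_rhs[OF has_derivative_cong_nhds[OF D ev]], rule ext)
    fix x
    have e': "E p powi (- 1) * cnj (E p powi (- 3)) = e"
      by (simp add: e_def power_int_minus divide_inverse)
    have "(Y (w p) + cnj (G p)) * (E p powi (- 1) * cnj (of_int (- 3) * E p powi (- 3) * dbeta p x)
          + of_int (- 1) * E p powi (- 1) * dbeta p x * cnj (E p powi (- 3)))
        + (deriv Y (w p) * q (w p) * dbeta p x
          + cnj (E p ^ 4 * q (w p) * dbeta p x + dg p * of_real (fst (snd x))))
          * (E p powi (- 1) * cnj (E p powi (- 3)))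
      = (E p powi (- 1) * cnj (E p powi (- 3))) * (S * (- 3 * cnj (dbeta p x) - dbeta p x)
        + (deriv Y (w p) * q (w p) * dbeta p x
          + cnj (E p ^ 4 * q (w p) * dbeta p x + dg p * of_real (fst (snd x)))))"
      unfolding S_def[symmetric] by (simp add: algebra_simps)
    also have "\<dots> = (deriv Y (w p) * q (w p) * e - S * e) * dbeta p x
      + (cnj (E p ^ 4 * q (w p)) * e - 3 * S * e) * cnj (dbeta p x)
      + cnj (dg p) * e * of_real (fst (snd x))"
      unfolding e' by (simp add: algebra_simps)
    finally show "(Y (w p) + cnj (G p)) * (E p powi (- 1) * cnj (of_int (- 3) * E p powi (- 3) * dbeta p x)
          + of_int (- 1) * E p powi (- 1) * dbeta p x * cnj (E p powi (- 3)))
        + (deriv Y (w p) * q (w p) * dbeta p x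
          + cnj (E p ^ 4 * q (w p) * dbeta p x + dg p * of_real (fst (snd x))))
          * (E p powi (- 1) * cnj (E p powi (- 3)))
      = (deriv Y (w p) * q (w p) * e - S * e) * dbeta p x
      + (cnj (E p ^ 4 * q (w p)) * e - 3 * S * e) * cnj (dbeta p x)
      + cnj (dg p) / (E p * cnj (E p) ^ 3) * of_real (fst (snd x))"
      by (simp add: e_def)
  qed
  then show ?thesis by (rule that)
qed

text \<open>By antisymmetry only the theta part of the third factor survives, multiplied by the
  determinant of the first two factors.\<close>

lemma wedge3_combination:
  "wedge3 (\<lambda>x. a1 * \<phi> x + a2 * \<psi> x) (\<lambda>x. b1 * \<phi> x + b2 * \<psi> x)
     (\<lambda>x. c1 * \<phi> x + c2 * \<psi> x + c3 * \<theta> x) x y z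
   = (a1 * b2 - a2 * b1) * c3 * wedge3 \<phi> \<psi> \<theta> x y z"
  unfolding wedge3_def by (simp add: algebra_simps)

lemma wedge3_alpha_nu:
  assumes "p \<in> M"
  shows "wedge3 (differential alpha p) (differential (\<lambda>q. cnj (alpha q)) p) (differential nu p) x y z
    = alpha p * cnj (alpha p) * (1 - A p * cnj (A p)) * (cnj (dg p) / (E p * cnj (E p) ^ 3))
      * wedge3 (dbeta p) (\<lambda>x. cnj (dbeta p x)) (\<lambda>x. of_real (fst (snd x))) x y z"
proof -
  obtain r1 r2 where nu: "(nu has_derivative (\<lambda>x. r1 * dbeta p x + r2 * cnj (dbeta p x)
      + cnj (dg p) / (E p * cnj (E p) ^ 3) * of_real (fst (snd x)))) (at p)"
    using has_derivative_nu[OF assms] .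
  have 1: "differential alpha p = (\<lambda>x. alpha p * dbeta p x + A p * alpha p * cnj (dbeta p x))"
    using differential_eq[OF has_derivative_alpha[OF assms]] by (simp add: A_eq[OF assms])
  have 2: "differential (\<lambda>q. cnj (alpha q)) p
      = (\<lambda>x. cnj (A p * alpha p) * dbeta p x + cnj (alpha p) * cnj (dbeta p x))"
    using differential_eq[OF has_derivative_cnj[OF has_derivative_alpha[OF assms]]]
    by (simp add: A_eq[OF assms] add.commute)
  show ?thesis
    unfolding 1 2 differential_eq[OF nu] wedge3_combination by (simp add: algebra_simps)
qed

text \<open>The test vectors are the two real zeta directions and the u direction; the value is - 2
  i |tau|^2.\<close>

lemma wedge3_dbeta_nonzero:
  assumes "p \<in> M"
  shows "wedge3 (dbeta p) (\<lambda>x. cnj (dbeta p x)) (\<lambda>x. of_real (fst (snd x)))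
    (1, 0, 0) (\<i>, 0, 0) (0, 1, 0) \<noteq> 0"
proof -
  define \<tau> where "\<tau> = upow (- ik) (fst (snd p)) / q (w p)"
  have "\<tau> \<noteq> 0" using q_nonzero[OF assms] by (simp add: \<tau>_def)
  moreover have "dbeta p (1, 0, 0) = \<tau>" "dbeta p (\<i>, 0, 0) = \<i> * \<tau>"
    by (simp_all add: dbeta_def dw_def \<tau>_def)
  ultimately show ?thesis by (simp add: wedge3_def)
qed

lemma wedge3_zero_iff:
  assumes "p \<in> M"
  shows "(\<forall>x y z. wedge3 (differential alpha p) (differential (\<lambda>q. cnj (alpha q)) p)
    (differential nu p) x y z = 0) \<longleftrightarrow> dg p = 0"
  using wedge3_dbeta_nonzero[OF assms] alpha_nonzero[OF assms] A_nondegenerate[OF assms]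
  by (auto simp: wedge3_alpha_nu[OF assms])

lemma Upsilon_hat_zero_iff: "p \<in> M \<Longrightarrow> Upsilon_hat p = 0 \<longleftrightarrow> dg p = 0"
  using u_pos'[of p] by (simp add: Upsilon_hat_eq)

text \<open>\<open>vector_derivative\<close> is meaningful only where a derivative exists;
  \<open>has_vector_derivative_g\<close> guarantees this on \<open>M\<close>.\<close>

lemma dg_zero_iff:
  "(\<forall>p\<in>M. dg p = 0) \<longleftrightarrow> (\<forall>\<zeta> u v. (\<zeta>, u, v) \<in> M \<longrightarrow> (g has_vector_derivative 0) (at u))"
proof -
  have "dg (\<zeta>, u, v) = 0 \<longleftrightarrow> (g has_vector_derivative 0) (at u)" if "(\<zeta>, u, v) \<in> M" for \<zeta> u v
  proof
    assume "dg (\<zeta>, u, v) = 0"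
    then show "(g has_vector_derivative 0) (at u)"
      using has_vector_derivative_g[OF that] unfolding dg_def by (simp only: fst_conv snd_conv)
  next
    assume "(g has_vector_derivative 0) (at u)"
    then show "dg (\<zeta>, u, v) = 0"
      unfolding dg_def fst_conv snd_conv by (rule vector_derivative_at)
  qed
  then show ?thesis by (metis prod_cases3)
qed

end

theorem proposition6p5:
  fixes M :: "point set"
    and f a L :: "complex \<Rightarrow> real \<Rightarrow> complex"
    and F :: "complex \<Rightarrow> complex" and g :: "real \<Rightarrow> complex" and k :: real
  assumes k: "k \<noteq> 0"
    and pp: "normalized_pp_wave M f a L"
    and F: "F analytic_on {of_real u powr (- \<i> * of_real k) * \<zeta> |\<zeta> u v. (\<zeta>, u, v) \<in> M}"
    and f: "\<And>\<zeta> u v. (\<zeta>, u, v) \<in> M \<Longrightarrow>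
      f \<zeta> u = F (of_real u powr (- \<i> * of_real k) * \<zeta>) * of_real u powr (- 2)
        + g u * of_real u powr (- 2 - \<i> * of_real k) * \<zeta>"
    and alpha: "\<And>p. p \<in> M \<Longrightarrow> normalized_pp_wave.alpha a p \<noteq> 0"
    and A: "\<And>p. p \<in> M \<Longrightarrow>
      normalized_pp_wave.A M f a p * cnj (normalized_pp_wave.A M f a p) \<noteq> 1"
    and B1: "\<And>p. p \<in> M \<Longrightarrow> Re (normalized_pp_wave.B M f a L p) \<noteq> 0"
  shows
    "((\<forall>p\<in>M. \<forall>x y z. wedge3
          (differential (normalized_pp_wave.alpha a) p)
          (differential (\<lambda>q. cnj (normalized_pp_wave.alpha a q)) p)
          (differential (normalized_pp_wave.nu M f a) p) x y z = 0)
        \<longleftrightarrow> (\<forall>p\<in>M. normalized_pp_wave.Upsilon_hat M f a L p = 0)) \<and>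
     ((\<forall>p\<in>M. normalized_pp_wave.Upsilon_hat M f a L p = 0)
        \<longleftrightarrow> (\<forall>\<zeta> u v. (\<zeta>, u, v) \<in> M \<longrightarrow> (g has_vector_derivative 0) (at u)))"
proof -
  interpret normalized_pp_wave M f a L by (rule pp)
  interpret power_wave M f a L F g k
    by unfold_locales (use F f alpha A in auto)
  \<comment> \<open>At each point of \<open>M\<close> the wedge condition and the vanishing of
    \<open>Upsilon_hat\<close> both amount to \<open>dg p = 0\<close>.\<close>
  show ?thesis
    unfolding dg_zero_iff[symmetric]
    by (simp only: wedge3_zero_iff Upsilon_hat_zero_iff cong: ball_cong)
qed

end
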